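(* There exist an absolute constant $C$ and a polynomial-time algorithm which, given any instance $G$ of general HCP (a directed graph with at least one arc), outputs a simple undirected cubic graph $G'$ such that $G'$ has a Hamiltonian cycle if and only if $G$ has a (directed) Hamiltonian cycle, and $G'$ has at most $Ck$ vertices and at most $Ck$ edges, where $k=\sum_{i}d_i$ and $d_i$ is the maximum of the in-degree and the out-degree of vertex $i$ of $G$.
   Context: An instance of general HCP is a finite directed graph with no loops and no two arcs with the same tail and head; an undirected edge $\{u,v\}$ is regarded as the pair of arcs $(u,v),(v,u)$. A Hamiltonian cycle of a directed graph is a directed cycle visiting every vertex exactly once; of an undirected graph, a cycle visiting every vertex exactly once. A graph is cubic if every vertex has degree 3. *)

theory Defs
  imports
    "Graph_Theory.Pair_Digraph"
    "HOL-Library.Log_Nat"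
    "HOL-Computational_Algebra.Polynomial"
begin

section \<open>Polynomial-time algorithms\<close>

text \<open>
  The machine model is a random access machine with logarithmic cost, presented as a structured
  programming language. The memory consists of arrays of natural numbers, unbounded and initially 0,
  of which a program can name only finitely many; a scalar variable is the cell 0 of an array. The
  arithmetic operations are addition and truncated subtraction. Every number that is read,
  computed or used as an address is charged its length in binary. This model and multitape Turing
  machines simulate each other with polynomial overhead.
\<close>

type_synonym aname = string
type_synonym state = "aname \<Rightarrow> nat \<Rightarrow> nat"

datatype exp =
    Const nat
  | Cell aname exp
  | Plus exp exp
  | Minus exp exp

datatype com =
    Skip
  | Assign aname exp exp  \<comment> \<open>\<open>Assign a i e\<close> stores the value of \<open>e\<close> in cell \<open>i\<close> of array \<open>a\<close>\<close>
  | Seq com com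
  | If exp com com        \<comment> \<open>a condition holds if its value is nonzero\<close>
  | While exp com

primrec val :: "exp \<Rightarrow> state \<Rightarrow> nat" where
  "val (Const n) s = n"
| "val (Cell a e) s = s a (val e s)"
| "val (Plus e1 e2) s = val e1 s + val e2 s"
| "val (Minus e1 e2) s = val e1 s - val e2 s"

text \<open>\<open>floorlog 2 n\<close> is the number of binary digits of \<open>n\<close> (with \<open>floorlog 2 0 = 0\<close>).\<close>

primrec cost :: "exp \<Rightarrow> state \<Rightarrow> nat" where
  "cost (Const n) s = 1 + floorlog 2 n"
| "cost (Cell a e) s = cost e s + 1 + floorlog 2 (val (Cell a e) s)"
| "cost (Plus e1 e2) s = cost e1 s + cost e2 s + 1 + floorlog 2 (val (Plus e1 e2) s)"
| "cost (Minus e1 e2) s = cost e1 s + cost e2 s + 1 + floorlog 2 (val (Minus e1 e2) s)"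

text \<open>\<open>exec c s t s'\<close>: started in \<open>s\<close>, the program \<open>c\<close> halts after time \<open>t\<close> in \<open>s'\<close>.\<close>

inductive exec :: "com \<Rightarrow> state \<Rightarrow> nat \<Rightarrow> state \<Rightarrow> bool" where
  Skip: "exec Skip s 1 s"
| Assign: "exec (Assign a i e) s (1 + cost i s + cost e s)
             (s(a := (s a)(val i s := val e s)))"
| Seq: "exec c1 s1 t1 s2 \<Longrightarrow> exec c2 s2 t2 s3 \<Longrightarrow> exec (Seq c1 c2) s1 (t1 + t2) s3"
| IfTrue: "val b s \<noteq> 0 \<Longrightarrow> exec c1 s t s' \<Longrightarrow> exec (If b c1 c2) s (1 + cost b s + t) s'"
| IfFalse: "val b s = 0 \<Longrightarrow> exec c2 s t s' \<Longrightarrow> exec (If b c1 c2) s (1 + cost b s + t) s'"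
| WhileFalse: "val b s = 0 \<Longrightarrow> exec (While b c) s (1 + cost b s) s"
| WhileTrue: "val b s1 \<noteq> 0 \<Longrightarrow> exec c s1 t1 s2 \<Longrightarrow> exec (While b c) s2 t2 s3 \<Longrightarrow>
    exec (While b c) s1 (1 + cost b s1 + t1 + t2) s3"

lemma exec_deterministic:
  "exec c s t s' \<Longrightarrow> exec c s u s'' \<Longrightarrow> t = u \<and> s' = s''"
proof (induction arbitrary: u s'' rule: exec.induct)
  case Skip
  from Skip.prems show ?case by cases simp
next
  case Assign
  from Assign.prems show ?case by cases simp
next
  case Seq
  from Seq.prems show ?case by cases (blast dest: Seq.IH)
next
  case IfTrue
  from IfTrue.prems show ?case
    by cases (simp_all add: IfTrue.hyps, blast dest: IfTrue.IH)
next
  case IfFalse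
  from IfFalse.prems show ?case
    by cases (simp_all add: IfFalse.hyps, blast dest: IfFalse.IH)
next
  case WhileFalse
  from WhileFalse.prems show ?case
    by cases (simp_all add: WhileFalse.hyps)
next
  case (WhileTrue b s1 c t1 s2 t2 s3)
  from WhileTrue.prems show ?case
  proof cases
    case WhileFalse
    with WhileTrue.hyps show ?thesis by simp
  next
    case 2: (WhileTrue t1' s2' t2')
    have 3: "t1 = t1'" "s2 = s2'"
      using WhileTrue.IH(1)[OF 2(3)] by simp_all
    have "t2 = t2'" "s3 = s''"
      using WhileTrue.IH(2) 2(4) 3 by blast+
    with 2(1) 3 show ?thesis by simp
  qed
qed

definition initial_state :: "nat list \<Rightarrow> state" where
  "initial_state xs = (\<lambda>a i.
     if a = ''in'' \<and> i < length xs then xs ! i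
     else if a = ''inlen'' \<and> i = 0 then length xs
     else 0)"

definition result :: "state \<Rightarrow> nat list" where
  "result s = map (s ''out'') [0..<s ''outlen'' 0]"

definition bitsize :: "nat list \<Rightarrow> nat" where
  "bitsize xs = (\<Sum>x\<leftarrow>xs. 1 + floorlog 2 x)"

text \<open>
  \<open>f\<close> is computable in polynomial time on \<open>D\<close>, with respect to the encodings \<open>enc\<close> and \<open>enc'\<close>.
  The size of the result is charged as well, since a program could otherwise announce an output
  whose length is exponential in its running time by merely setting \<open>''outlen''\<close>.
\<close>

definition polytime_computable_on ::
    "'a set \<Rightarrow> ('a \<Rightarrow> nat list) \<Rightarrow> ('b \<Rightarrow> nat list) \<Rightarrow> ('a \<Rightarrow> 'b) \<Rightarrow> bool" where
  "polytime_computable_on D enc enc' f \<longleftrightarrow>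
     (\<exists>(c :: com) (p :: nat poly). \<forall>x\<in>D. \<exists>t s.
        exec c (initial_state (enc x)) t s \<and>
        result s = enc' (f x) \<and>
        t + bitsize (result s) \<le> poly p (bitsize (enc x)))"

section \<open>Graphs\<close>

text \<open>
  As usual for algorithms on graphs, the vertices are numbered consecutively, and a graph is given by
  its number of vertices and its adjacency matrix, row by row.
\<close>

definition numbered :: "nat pair_pre_digraph \<Rightarrow> bool" where
  "numbered G \<longleftrightarrow> (\<exists>n. pverts G = {..<n})"

definition encode :: "nat pair_pre_digraph \<Rightarrow> nat list" where
  "encode G = (let n = card (pverts G) in
     n # [if (i, j) \<in> parcs G then 1 else 0. i \<leftarrow> [0..<n], j \<leftarrow> [0..<n]])"

text \<open>
  \<open>pair_digraph\<close>: finite, without loops; there are no parallel arcs as arcs are pairs of vertices.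
\<close>

definition hcp_instance :: "nat pair_pre_digraph \<Rightarrow> bool" where
  "hcp_instance G \<longleftrightarrow> pair_digraph G \<and> numbered G \<and> parcs G \<noteq> {}"

text \<open>
  \<open>pre_digraph.cycle\<close> is a nonempty closed walk whose vertices, apart from the coincidence of the
  first and the last one, are distinct.
\<close>

definition directed_hamiltonian :: "'a pair_pre_digraph \<Rightarrow> bool" where
  "directed_hamiltonian G \<longleftrightarrow>
     (\<exists>p. pre_digraph.cycle (with_proj G) p \<and> fst ` set p = pverts G)"

text \<open>
  An undirected graph is a symmetric digraph (\<open>pair_graph\<close>). Traversing one edge back and forth is
  a cycle of this digraph but not of the undirected graph, hence the bound on the length.
\<close>

definition undirected_hamiltonian :: "'a pair_pre_digraph \<Rightarrow> bool" where
  "undirected_hamiltonian G \<longleftrightarrow>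
     (\<exists>p. pre_digraph.cycle (with_proj G) p \<and> 3 \<le> length p \<and> fst ` set p = pverts G)"

text \<open>In a symmetric digraph, the out-degree of a vertex is its degree in the undirected graph.\<close>

definition cubic :: "'a pair_pre_digraph \<Rightarrow> bool" where
  "cubic G \<longleftrightarrow> (\<forall>v\<in>pverts G. out_degree (with_proj G) v = 3)"

definition undirected_edges :: "'a pair_pre_digraph \<Rightarrow> 'a set set" where
  "undirected_edges G = {{u, v} | u v. (u, v) \<in> parcs G}"

definition degree_sum :: "'a pair_pre_digraph \<Rightarrow> nat" where
  "degree_sum G =
     (\<Sum>v\<in>pverts G. max (in_degree (with_proj G) v) (out_degree (with_proj G) v))"

end

theory Submission
  imports Defs
begin

text \<open>
  Replace every vertex \<open>v\<close> of the digraph by two ladders, one for the arcs entering \<open>v\<close> and one for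
  the arcs leaving it, which have one column per arc and are joined at their left ends. The two
  columns of an arc are connected by an edge between their ports. A column is made such that, by
  degree constraints and connectivity alone, a Hamiltonian cycle uses the lower rail everywhere, and
  the upper rail exactly from the right end of the ladder to a column whose port is used. Hence it
  uses exactly one entering and one leaving arc of each \<open>v\<close>: otherwise no port would be used, and
  the two ladders of \<open>v\<close> would contain a closed component. Conversely, from any port there is a
  Hamiltonian path of the ladder to its left end. There are 30 vertices per arc.
\<close>

section \<open>Hamiltonian cycles as vertex lists\<close>

text \<open>The upper rail acts as a signal. Hence a line has at most one used port, and none
  precisely if the signal reaches the left end, where both lines of the vertex share it. One used
  port in every line is all that the directions of the arcs demand, so an undirected cycle can
  express a directed one. Degrees are unbounded, so "exactly one arc" cannot be a single gadget of
  fixed size; spread over columns of fixed size it costs a constant per arc, and there are at most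
  \<open>k\<close> arcs. A vertex without an entering or a leaving arc would have an empty line.
  Such a digraph is not Hamiltonian and is exchanged for a fixed non-Hamiltonian one with 4 arcs,
  which is the origin of a factor 4 in the bound. The machine has neither multiplication nor
  division, so the program keeps all addresses as running sums.\<close>

definition ham :: "('a \<times> 'a) set \<Rightarrow> 'a set \<Rightarrow> 'a list \<Rightarrow> bool" where
  "ham E V vs \<longleftrightarrow> vs \<noteq> [] \<and> distinct vs \<and> set vs = V \<and>
     successively (\<lambda>x y. (x, y) \<in> E) (vs @ [hd vs])"

lemma pcas_successively:
  assumes "pcas u p w" "set p \<subseteq> E"
  shows "successively (\<lambda>x y. (x, y) \<in> E) (map fst p @ [w]) \<and>
    hd (map fst p @ [w]) = u \<and> pawalk_verts u p = map fst p @ [w]"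
  using assms by (induction p arbitrary: u) (auto simp: successively_Cons)

lemma successively_pcas:
  assumes "vs \<noteq> []" "successively (\<lambda>x y. (x, y) \<in> E) (vs @ [w])"
  shows "\<exists>p. pcas (hd vs) p w \<and> set p \<subseteq> E \<and> map fst p = vs"
  using assms
proof (induction vs)
  case (Cons v vs)
  show ?case
  proof (cases "vs = []")
    case True
    with Cons.prems show ?thesis
      by (intro exI[of _ "[(v, w)]"]) simp
  next
    case False
    with Cons obtain p where "pcas (hd vs) p w" "set p \<subseteq> E" "map fst p = vs"
      by (auto simp: successively_Cons)
    with False Cons.prems show ?thesis
      by (intro exI[of _ "(v, hd vs) # p"]) (auto simp: successively_Cons)
  qed
qed simp

text \<open>The list consists of the tails of the arcs of the walk, and the wrap-around step of
  \<open>ham\<close> is its last arc. With \<open>k\<close> equal to 0 or 3 this serves the directed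
  and the undirected notion.\<close>

lemma hamiltonian_iff_ham:
  assumes "pair_wf_digraph G"
  shows "(\<exists>p. pre_digraph.cycle (with_proj G) p \<and> k \<le> length p \<and> fst ` set p = pverts G) \<longleftrightarrow>
    (\<exists>vs. ham (parcs G) (pverts G) vs \<and> k \<le> length vs)" (is "?L \<longleftrightarrow> ?R")
proof -
  interpret pair_wf_digraph G by fact
  show ?thesis
  proof
    assume ?L
    then obtain p u where p: "set p \<subseteq> parcs G" "pcas u p u" "distinct (tl (pawalk_verts u p))" "p \<noteq> []"
      "k \<le> length p" "fst ` set p = pverts G"
      by (auto simp: cycle_def awalk_def)
    with pcas_successively[of u p u "parcs G"] show ?R
      by (intro exI[of _ "map fst p"]) (cases p; auto simp: ham_def)
  next
    assume ?R
    then obtain vs where vs: "ham (parcs G) (pverts G) vs" "k \<le> length vs" by blast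
    then obtain p where p: "pcas (hd vs) p (hd vs)" "set p \<subseteq> parcs G" "map fst p = vs"
      using successively_pcas[of vs "parcs G" "hd vs"] by (auto simp: ham_def)
    have v: "fst ` set p = pverts G" "length p = length vs" "distinct (map fst p)" "p \<noteq> []" "hd vs \<in> pverts G"
      using vs unfolding ham_def p(3)[symmetric]
      by (simp_all, metis image_set length_greater_0_conv list.set_sel(1) list.map_disc_iff)
    obtain e p' where "p = e # p'" using v(4) by (cases p) auto
    with v(3) have "distinct (tl (map fst p @ [fst e]))" "hd vs = fst e"
      using p(3) by auto
    then have "cycle p"
      unfolding cycle_def awalk_def
      using p v pcas_successively[OF p(1,2)] by (intro exI[of _ "hd vs"]) simp
    then show ?L using v(1,2) vs(2) by auto
  qed
qed

lemma directed_hamiltonian_iff: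
  assumes "pair_wf_digraph G"
  shows "directed_hamiltonian G \<longleftrightarrow> (\<exists>vs. ham (parcs G) (pverts G) vs)"
  using hamiltonian_iff_ham[OF assms, of 0] by (simp add: directed_hamiltonian_def)

lemma undirected_hamiltonian_iff:
  assumes "pair_wf_digraph G"
  shows "undirected_hamiltonian G \<longleftrightarrow> (\<exists>vs. ham (parcs G) (pverts G) vs \<and> 3 \<le> length vs)"
  using hamiltonian_iff_ham[OF assms, of 3] by (simp add: undirected_hamiltonian_def)

lemma ham_map:
  assumes "ham E V vs" "inj_on h V"
  shows "ham (map_prod h h ` E) (h ` V) (map h vs)"
proof -
  have "successively (\<lambda>x y. (h x, h y) \<in> map_prod h h ` E) (vs @ [hd vs])"
    by (rule successively_mono[of "\<lambda>x y. (x, y) \<in> E"]) (use assms in \<open>auto simp: ham_def\<close>)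
  then have "successively (\<lambda>x y. (x, y) \<in> map_prod h h ` E) (map h (vs @ [hd vs]))"
    by (simp only: successively_map)
  then show ?thesis
    using assms by (simp add: ham_def distinct_map hd_map)
qed

text \<open>\<open>ham_map\<close> along \<open>h\<close> and along its inverse on \<open>V\<close>.
  The gadgets live on triples, but the output must have numbered vertices.\<close>

lemma ham_image_iff:
  assumes h: "inj_on h V" and E: "E \<subseteq> V \<times> V"
  shows "(\<exists>vs. ham (map_prod h h ` E) (h ` V) vs \<and> k \<le> length vs) \<longleftrightarrow>
    (\<exists>vs. ham E V vs \<and> k \<le> length vs)"
proof -
  let ?g = "inv_into V h"
  have gh: "?g (h x) = x" if "x \<in> V" for x using that h by simp
  have "map_prod ?g ?g ` map_prod h h ` E = E"
  proof -
    have "map_prod ?g ?g ` map_prod h h ` E = (\<lambda>e. e) ` E"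
      unfolding image_image using E gh by (intro image_cong) auto
    then show ?thesis by simp
  qed
  moreover have "?g ` h ` V = V" using gh by (simp add: image_image)
  moreover have "inj_on ?g (h ` V)" by (simp add: inj_on_inv_into)
  ultimately show ?thesis
    using ham_map[of "map_prod h h ` E" "h ` V" _ ?g] ham_map[OF _ h, of E]
    by (metis length_map)
qed

lemma ham_next:
  assumes "ham E V vs" "i < length vs"
  shows "(vs ! i, vs ! (Suc i mod length vs)) \<in> E"
proof -
  have "((vs @ [hd vs]) ! i, (vs @ [hd vs]) ! Suc i) \<in> E"
    using assms by (auto simp: ham_def successively_conv_nth)
  moreover have "hd vs = vs ! 0" using assms by (simp add: ham_def hd_conv_nth)
  ultimately show ?thesis using assms(2)
    by (cases "Suc i = length vs") (auto simp: nth_append split: if_splits)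
qed

text \<open>Starting at the position of \<open>x\<close>, counting upwards modulo the length reaches
  every position.\<close>

lemma ham_succ_closed:
  assumes vs: "ham E V vs" and x: "x \<in> X" "x \<in> V"
    and X: "\<And>i. i < length vs \<Longrightarrow> vs ! i \<in> X \<Longrightarrow> vs ! (Suc i mod length vs) \<in> X"
  shows "V \<subseteq> X"
proof -
  define L where "L = length vs"
  have L: "0 < L" and V: "set vs = V" using vs by (auto simp: L_def ham_def)
  obtain i where i: "i < L" "vs ! i = x" using x(2) V by (metis L_def in_set_conv_nth)
  have *: "vs ! ((i + k) mod L) \<in> X" for k
  proof (induction k)
    case (Suc k)
    have "vs ! (Suc ((i + k) mod L) mod L) \<in> X"
      using Suc L unfolding L_def by (intro X) simp_all
    then show ?case by (simp add: mod_Suc_eq)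
  qed (use i x in simp)
  have "vs ! j \<in> X" if "j < L" for j
    using *[of "L - i + j"] i that by simp
  then show ?thesis using V by (auto simp: L_def in_set_conv_nth)
qed

lemma ham_degrees:
  assumes vs: "ham E V vs" and v: "v \<in> V"
  shows "v \<in> fst ` E" "v \<in> snd ` E"
proof -
  obtain i where i: "i < length vs" "vs ! i = v" using v vs by (metis ham_def in_set_conv_nth)
  from ham_next[OF vs i(1)] i show "v \<in> fst ` E" by force
  define j where "j = (if i = 0 then length vs - 1 else i - 1)"
  have "j < length vs" "Suc j mod length vs = i" using i by (auto simp: j_def)
  with ham_next[OF vs, of j] i show "v \<in> snd ` E" by force
qed

text \<open>The analysis of the gadgets needs no order of traversal, only a symmetric edge set with
  degrees 2 and with connectivity, expressed by closed sets.\<close>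

lemma ham_two_regular:
  assumes vs: "ham E V vs" and L: "3 \<le> length vs" and E: "sym E"
  shows "\<exists>H. sym H \<and> H \<subseteq> E \<and> (\<forall>x\<in>V. card (H `` {x}) = 2) \<and>
    (\<forall>X\<subseteq>V. X \<noteq> {} \<longrightarrow> H `` X \<subseteq> X \<longrightarrow> X = V)"
proof -
  define L where "L = length vs"
  define H where "H = {(x, y). \<exists>i<L. (x = vs ! i \<and> y = vs ! (Suc i mod L)) \<or> (y = vs ! i \<and> x = vs ! (Suc i mod L))}"
  have L3: "3 \<le> L" and d: "distinct vs" and V: "set vs = V" using assms by (auto simp: L_def ham_def)
  have next_E: "(vs ! i, vs ! (Suc i mod L)) \<in> E" if "i < L" for i
    using ham_next[OF vs] that by (simp add: L_def)
  have "H \<subseteq> E" using next_E E by (auto simp: H_def sym_def)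
  moreover have "sym H" by (auto simp: H_def sym_def)
  moreover have "card (H `` {x}) = 2" if x: "x \<in> V" for x
  proof -
    obtain i where i: "i < L" "x = vs ! i" using x V by (metis L_def in_set_conv_nth)
    define j where "j = (if i = 0 then L - 1 else i - 1)"
    have eq: "vs ! a = vs ! b \<longleftrightarrow> a = b" if "a < L" "b < L" for a b
      using d that by (simp add: L_def nth_eq_iff_index_eq)
    have j: "j < L" "Suc j mod L = i" using i L3 by (auto simp: j_def)
    have j': "k = j" if "k < L" "Suc k mod L = i" for k
      using that L3 by (cases "Suc k = L") (auto simp: j_def)
    have S: "Suc i mod L < L" using L3 by auto
    \<comment> \<open>Successor and predecessor differ because the length is at least 3; in a cycle
      of length 2 they would coincide.\<close>
    have "Suc i mod L \<noteq> j" using i L3 by (cases "Suc i = L") (auto simp: j_def)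
    moreover have "H `` {x} = {vs ! (Suc i mod L), vs ! j}"
    proof (intro equalityI subsetI)
      fix y assume "y \<in> H `` {x}"
      then obtain k where k: "k < L" "x = vs ! k \<and> y = vs ! (Suc k mod L) \<or> y = vs ! k \<and> x = vs ! (Suc k mod L)"
        by (auto simp: H_def)
      then show "y \<in> {vs ! (Suc i mod L), vs ! j}"
        using i j' eq[of i k] eq[of i "Suc k mod L"] L3 by auto
    next
      fix y assume "y \<in> {vs ! (Suc i mod L), vs ! j}"
      then show "y \<in> H `` {x}" using i j by (auto simp: H_def)
    qed
    ultimately show ?thesis using eq[OF S j(1)] by simp
  qed
  moreover have "X = V" if X: "X \<subseteq> V" "X \<noteq> {}" "H `` X \<subseteq> X" for X
  proof -
    obtain x where x: "x \<in> X" using X(2) by blast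
    have "vs ! (Suc i mod length vs) \<in> X" if "i < length vs" "vs ! i \<in> X" for i
    proof -
      have "(vs ! i, vs ! (Suc i mod L)) \<in> H" using that(1) by (auto simp: H_def L_def)
      then show ?thesis using that(2) X(3) by (auto simp: L_def)
    qed
    with ham_succ_closed[OF vs x] X(1) x show ?thesis by blast
  qed
  ultimately show ?thesis by blast
qed

text \<open>Follow \<open>\<sigma>\<close> from any point up to the first repetition. From the point
  of re-entry on, and from any earlier point on, the orbit is closed and therefore all of
  \<open>V\<close>. So the start itself lies on the loop, and the loop covers
  \<open>V\<close>.\<close>

lemma ham_of_permutation:
  fixes \<sigma> :: "'a \<Rightarrow> 'a"
  assumes "finite V" "V \<noteq> {}" and \<sigma>: "\<And>v. v \<in> V \<Longrightarrow> \<sigma> v \<in> V \<and> (v, \<sigma> v) \<in> E"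
    and conn: "\<And>X. X \<subseteq> V \<Longrightarrow> X \<noteq> {} \<Longrightarrow> \<sigma> ` X \<subseteq> X \<Longrightarrow> X = V"
  shows "\<exists>vs. ham E V vs"
proof -
  obtain v where v: "v \<in> V" using assms by blast
  define f where "f i = (\<sigma> ^^ i) v" for i
  have f0: "f 0 = v" and fS: "f (Suc i) = \<sigma> (f i)" for i by (simp_all add: f_def)
  have fV: "f i \<in> V" for i by (induction i) (auto simp: f0 fS v \<sigma>)
  have "\<exists>i. f i \<in> f ` {..<i}"
  proof (rule ccontr)
    assume *: "\<not> ?thesis"
    have "inj f"
    proof (rule linorder_injI)
      fix x y :: nat assume "x < y"
      with * show "f x \<noteq> f y" by (metis imageI lessThan_iff)
    qed
    then show False using finite_subset[of "range f" V] fV \<open>finite V\<close> finite_imageD by blast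
  qed
  then obtain L where L: "f L \<in> f ` {..<L}" "\<And>i. i < L \<Longrightarrow> f i \<notin> f ` {..<i}"
    using exists_least_iff[of "\<lambda>i. f i \<in> f ` {..<i}"] by auto
  have inj: "inj_on f {..<L}"
    by (rule linorder_inj_onI) (use L in \<open>auto, metis imageI lessThan_iff\<close>)
  obtain j where j: "j < L" "f L = f j" using L by auto
  have tail: "f ` {i..<L} = V" if ij: "i \<le> j" for i
  proof (rule conn)
    show "f ` {i..<L} \<subseteq> V" using fV by auto
    show "f ` {i..<L} \<noteq> {}" using ij j by auto
    have "\<sigma> (f k) \<in> f ` {i..<L}" if k: "i \<le> k" "k < L" for k
      using k j ij by (cases "Suc k = L") (auto simp: fS[symmetric])
    then show "\<sigma> ` f ` {i..<L} \<subseteq> f ` {i..<L}" by auto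
  qed
  have "j = 0"
  proof -
    have "v \<in> f ` {j..<L}" using tail v by simp
    then obtain i where "f 0 = f i" "j \<le> i" "i < L" by (auto simp: f0)
    with inj show ?thesis by (force simp: inj_on_def)
  qed
  let ?vs = "map f [0..<L]"
  have "ham E V ?vs"
    unfolding ham_def
  proof (intro conjI)
    show "set ?vs = V" using tail[of 0] by (simp add: atLeast0LessThan)
    show "distinct ?vs" using inj by (simp add: distinct_map atLeast0LessThan)
    have "?vs @ [hd ?vs] = map f [0..<Suc L]"
      using j \<open>j = 0\<close> by (simp add: hd_map)
    then show "successively (\<lambda>x y. (x, y) \<in> E) (?vs @ [hd ?vs])"
      using \<sigma> fV by (simp add: successively_conv_nth del: upt_Suc) (simp add: fS)
  qed (use j in simp)
  then show ?thesis by blast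
qed

section \<open>The gadgets\<close>

text \<open>
  Every arc has two columns, one for its tail (side \<open>False\<close>) and one for its head (side \<open>True\<close>), and a
  column has the following 15 vertices. The port \<open>Pt\<close> is joined to the port of the other column of
  the arc. The upper and lower rails \<open>UL\<close>, \<open>UR\<close>, \<open>LL\<close>, \<open>LR\<close> lead to the next column on the left or on
  the right. The diamond \<open>Da\<close>, \<dots>, \<open>Dd\<close> replaces a vertex of degree 2, that is, it forces a Hamiltonian
  cycle to connect \<open>Pt\<close> and \<open>Ca\<close> through it; \<open>Ea\<close>, \<dots>, \<open>Ed\<close> does so for \<open>UL\<close> and \<open>Cb\<close>.
\<close>

datatype role = Pt | UL | UR | LL | LR | Ca | Cb | Da | Db | Dc | Dd | Ea | Eb | Ec | Ed

fun inner :: "role \<Rightarrow> role list" where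
  "inner Pt = [UR, Da]"
| "inner UL = [UR, Ea]"
| "inner UR = [Pt, UL]"
| "inner LL = [Ca, Cb]"
| "inner LR = [Ca, Cb]"
| "inner Ca = [Dd, LL, LR]"
| "inner Cb = [Ed, LL, LR]"
| "inner Da = [Pt, Db, Dc]"
| "inner Db = [Da, Dc, Dd]"
| "inner Dc = [Da, Db, Dd]"
| "inner Dd = [Db, Dc, Ca]"
| "inner Ea = [UL, Eb, Ec]"
| "inner Eb = [Ea, Ec, Ed]"
| "inner Ec = [Ea, Eb, Ed]"
| "inner Ed = [Eb, Ec, Cb]"

text \<open>The roles with only two neighbours inside the column; \<open>ext\<close> supplies the
  third.\<close>

definition terminals :: "role set" where
  "terminals = {Pt, UL, UR, LL, LR}"

type_synonym vertex = "nat \<times> bool \<times> role"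

text \<open>The vertex of the digraph to whose line the column of \<open>e\<close> on side
  \<open>s\<close> belongs.\<close>

definition key :: "(nat \<times> nat) list \<Rightarrow> bool \<Rightarrow> nat \<Rightarrow> nat" where
  "key as s e = (if s then snd (as ! e) else fst (as ! e))"

definition cols :: "(nat \<times> nat) list \<Rightarrow> bool \<Rightarrow> nat \<Rightarrow> nat list" where
  "cols as s v = filter (\<lambda>e. key as s e = v) [0..<length as]"

text \<open>The columns to the right of \<open>e\<close> in its line, the nearest one last;
  \<open>after\<close> has those to the left, the nearest one first.\<close>

definition before :: "(nat \<times> nat) list \<Rightarrow> bool \<Rightarrow> nat \<Rightarrow> nat list" where
  "before as s e = filter (\<lambda>e'. key as s e' = key as s e) [0..<e]"

definition after :: "(nat \<times> nat) list \<Rightarrow> bool \<Rightarrow> nat \<Rightarrow> nat list" where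
  "after as s e = filter (\<lambda>e'. key as s e' = key as s e) [Suc e..<length as]"

text \<open>
  The columns of the arcs with the same tail (or the same head) are lined up from right to left. At
  the right end the two rails are joined to each other; at the left end they are joined to those of
  the line of the same vertex on the other side.
\<close>

fun ext :: "(nat \<times> nat) list \<Rightarrow> vertex \<Rightarrow> vertex" where
  "ext as (e, s, r) = (case r of
      Pt \<Rightarrow> (e, \<not> s, Pt)
    | UR \<Rightarrow> if before as s e = [] then (e, s, LR) else (last (before as s e), s, UL)
    | LR \<Rightarrow> if before as s e = [] then (e, s, UR) else (last (before as s e), s, LL)
    | UL \<Rightarrow> if after as s e = [] then (last (cols as (\<not> s) (key as s e)), \<not> s, UL)
            else (hd (after as s e), s, UR)
    | LL \<Rightarrow> if after as s e = [] then (last (cols as (\<not> s) (key as s e)), \<not> s, LL)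
            else (hd (after as s e), s, LR)
    | _ \<Rightarrow> (e, s, r))"

definition gverts :: "(nat \<times> nat) list \<Rightarrow> vertex set" where
  "gverts as = {..<length as} \<times> UNIV"

fun nbs :: "(nat \<times> nat) list \<Rightarrow> vertex \<Rightarrow> vertex list" where
  "nbs as (e, s, r) =
     (if r \<in> terminals then [ext as (e, s, r)] else []) @ map (\<lambda>r'. (e, s, r')) (inner r)"

definition garcs :: "(nat \<times> nat) list \<Rightarrow> (vertex \<times> vertex) set" where
  "garcs as = {(x, y). x \<in> gverts as \<and> y \<in> set (nbs as x)}"

lemma upt_split: "e < m \<Longrightarrow> [0..<m] = [0..<e] @ e # [Suc e..<m]"
  by (metis le_add_diff_inverse less_imp_le_nat upt_add_eq_append upt_conv_Cons zero_le)

lemma filter_upt_snoc: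
  assumes "filter P [a..<b] = xs @ [c]"
  shows "filter P [a..<c] = xs" "P c" "a \<le> c" "c < b" "filter P [Suc c..<b] = []"
proof -
  have "c \<in> set (filter P [a..<b])" using assms by simp
  then show c: "P c" "a \<le> c" "c < b" by auto
  then have "[a..<b] = [a..<c] @ c # [Suc c..<b]"
    by (metis le_add_diff_inverse less_imp_le_nat upt_add_eq_append upt_conv_Cons)
  then have eq: "filter P [a..<c] @ c # filter P [Suc c..<b] = xs @ [c]" using assms c by simp
  moreover have "filter P [Suc c..<b] = []"
  proof (rule ccontr)
    assume n: "filter P [Suc c..<b] \<noteq> []"
    then have "last (filter P [Suc c..<b]) \<in> set (filter P [Suc c..<b])" by (rule last_in_set)
    moreover have "last (filter P [Suc c..<b]) = c"
      using arg_cong[OF eq, of last] n by simp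
    ultimately show False by auto
  qed
  ultimately show "filter P [a..<c] = xs" "filter P [Suc c..<b] = []" by auto
qed

lemma filter_upt_Cons:
  assumes "filter P [a..<b] = c # xs"
  shows "filter P [a..<c] = []" "P c" "a \<le> c" "c < b" "filter P [Suc c..<b] = xs"
proof -
  have "c \<in> set (filter P [a..<b])" using assms by simp
  then show c: "P c" "a \<le> c" "c < b" by auto
  then have "[a..<b] = [a..<c] @ c # [Suc c..<b]"
    by (metis le_add_diff_inverse less_imp_le_nat upt_add_eq_append upt_conv_Cons)
  then have eq: "filter P [a..<c] @ c # filter P [Suc c..<b] = c # xs" using assms c by simp
  moreover have "filter P [a..<c] = []"
  proof (rule ccontr)
    assume n: "filter P [a..<c] \<noteq> []"
    then have "hd (filter P [a..<c]) \<in> set (filter P [a..<c])" by (rule hd_in_set)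
    moreover have "hd (filter P [a..<c]) = c" using eq n by (cases "filter P [a..<c]") auto
    ultimately show False by auto
  qed
  ultimately show "filter P [a..<c] = []" "filter P [Suc c..<b] = xs" by auto
qed

section \<open>Symmetry, simplicity and 3-regularity of the gadget graph\<close>

locale reduction =
  fixes n :: nat and as :: "(nat \<times> nat) list"
  assumes as_lt: "(u, v) \<in> set as \<Longrightarrow> u < n \<and> v < n \<and> u \<noteq> v"
    and dist: "distinct as"
    and out_ex: "v < n \<Longrightarrow> v \<in> fst ` set as"
    and in_ex: "v < n \<Longrightarrow> v \<in> snd ` set as"
    and pos: "0 < n"
begin

abbreviation "m \<equiv> length as"
abbreviation "V \<equiv> gverts as"
abbreviation "E \<equiv> garcs as"

lemma key_lt: "e < m \<Longrightarrow> key as s e < n"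
  using as_lt[of "fst (as ! e)" "snd (as ! e)"] by (auto simp: key_def)

lemma key_neq: "e < m \<Longrightarrow> key as s e \<noteq> key as (\<not> s) e"
  using as_lt[of "fst (as ! e)" "snd (as ! e)"] by (auto simp: key_def)

text \<open>Makes both lines of every vertex nonempty, so that the left ends mentioned in
  \<open>ext\<close> exist.\<close>

lemma key_surj: "v < n \<Longrightarrow> \<exists>e<m. key as s e = v"
  using out_ex[of v] in_ex[of v] by (cases s) (fastforce simp: key_def in_set_conv_nth)+

lemma in_cols: "e \<in> set (cols as s v) \<longleftrightarrow> e < m \<and> key as s e = v"
  by (auto simp: cols_def)

lemma cols_nonempty: "v < n \<Longrightarrow> cols as s v \<noteq> []"
  using key_surj[of v s] in_cols[of _ s v] by force

lemma last_cols: "v < n \<Longrightarrow> last (cols as s v) < m \<and> key as s (last (cols as s v)) = v"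
  using last_in_set[OF cols_nonempty] in_cols by blast

lemma cols_split: "e < m \<Longrightarrow> cols as s (key as s e) = before as s e @ e # after as s e"
  unfolding cols_def before_def after_def by (subst upt_split[of e]) auto

text \<open>Splitting \<open>cols\<close> at \<open>c\<close> and at \<open>e\<close> gives the same
  list; hence being the right-hand neighbour and being the left-hand neighbour are inverse
  relations.\<close>

lemma before_snoc:
  assumes "before as s e = xs @ [c]" "e < m"
  shows "before as s c = xs" "key as s c = key as s e" "c < e" "after as s c = e # after as s e"
proof -
  note * = filter_upt_snoc[OF assms(1)[unfolded before_def]]
  show k: "key as s c = key as s e" "c < e" using * by auto
  show b: "before as s c = xs" using * by (simp add: before_def)
  have "cols as s (key as s e) = xs @ c # after as s c"
    using cols_split[of c s] k b assms by simp
  then show "after as s c = e # after as s e"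
    using cols_split[OF assms(2), of s] assms(1) by simp
qed

lemma after_Cons:
  assumes "after as s e = c # xs" "e < m"
  shows "after as s c = xs" "key as s c = key as s e" "e < c" "c < m" "before as s c = before as s e @ [e]"
proof -
  note * = filter_upt_Cons[OF assms(1)[unfolded after_def]]
  show k: "key as s c = key as s e" "e < c" "c < m" using * by auto
  show b: "after as s c = xs" using * by (simp add: after_def)
  have "cols as s (key as s e) = before as s c @ c # xs"
    using cols_split[of c s] k b assms by simp
  then show "before as s c = before as s e @ [e]"
    using cols_split[OF assms(2), of s] assms(1) by simp
qed

lemma after_last_cols: "v < n \<Longrightarrow> after as s (last (cols as s v)) = []"
  using filter_upt_snoc[of "\<lambda>e. key as s e = v" 0 m "butlast (cols as s v)" "last (cols as s v)"]
    cols_nonempty[of v s] last_cols[of v s] by (simp add: cols_def after_def)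

lemma last_cols_eq: "e < m \<Longrightarrow> after as s e = [] \<Longrightarrow> last (cols as s (key as s e)) = e"
  by (simp add: cols_split)

text \<open>The outer edges form a perfect matching of the terminals. They stay at one vertex of the
  digraph except between ports, and never duplicate an inner edge. Symmetry, absence of loops and of
  parallel edges, and the degree 3 all rest on this.\<close>

lemma ext_props:
  assumes e: "e < m" and r: "r \<in> terminals" and x: "ext as (e, s, r) = (e', s', r')"
  shows "e' < m \<and> r' \<in> terminals \<and> ext as (e', s', r') = (e, s, r) \<and>
    (r \<noteq> Pt \<longrightarrow> key as s' e' = key as s e) \<and> (e', s', r') \<noteq> (e, s, r) \<and>
    (e' = e \<and> s' = s \<longrightarrow> r' \<notin> set (inner r))"
proof (cases "r = UR \<or> r = LR")
  case True
  show ?thesis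
  proof (cases "before as s e = []")
    case False
    then obtain xs c where "before as s e = xs @ [c]" by (metis rev_exhaust)
    with before_snoc[OF this e] True x e show ?thesis
      by (auto simp: terminals_def)
  qed (use True assms in \<open>auto simp: terminals_def\<close>)
next
  case False
  show ?thesis
  proof (cases "after as s e")
    case Nil
    with False assms show ?thesis
      using last_cols[OF key_lt[OF e], of "\<not> s" s] after_last_cols[OF key_lt[OF e], of "\<not> s" s]
        last_cols_eq[OF e]
      by (auto simp: terminals_def)
  next
    case (Cons c xs)
    with False assms after_Cons[OF Cons e] show ?thesis
      by (auto simp: terminals_def)
  qed
qed

lemma inner_sym: "r' \<in> set (inner r) \<longleftrightarrow> r \<in> set (inner r')"
  by (cases r; cases r') simp_all

lemma distinct_inner: "distinct (inner r)" "r \<notin> set (inner r)"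
  "length (inner r) = (if r \<in> terminals then 2 else 3)"
  by (cases r; simp add: terminals_def)+

lemma garcs_iff:
  "((e, s, r), (e', s', r')) \<in> E \<longleftrightarrow>
    e < m \<and> (e' = e \<and> s' = s \<and> r' \<in> set (inner r) \<or> r \<in> terminals \<and> ext as (e, s, r) = (e', s', r'))"
  by (auto simp: garcs_def gverts_def simp del: ext.simps)

lemma garcs_sym: "sym E"
proof (rule symI)
  fix x y assume "(x, y) \<in> E"
  moreover obtain e s r e' s' r' where "x = (e, s, r)" "y = (e', s', r')" by (metis surj_pair)
  ultimately show "(y, x) \<in> E"
    using ext_props[of e r s e' s' r'] inner_sym[of r r'] by (auto simp: garcs_iff simp del: ext.simps)
qed

lemma distinct_nbs: 
  assumes "e < m" shows "distinct (nbs as (e, s, r)) \<and> length (nbs as (e, s, r)) = 3"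
proof -
  obtain e' s' r' where "ext as (e, s, r) = (e', s', r')" by (metis surj_pair)
  then show ?thesis
    using ext_props[OF assms, of r s e' s' r'] distinct_inner[of r]
    by (auto simp: distinct_map inj_on_def simp del: ext.simps)
qed

lemma garcs_sub: "E \<subseteq> V \<times> V"
proof
  fix p assume "p \<in> E"
  moreover obtain e s r e' s' r' where "p = ((e, s, r), (e', s', r'))" by (metis surj_pair)
  ultimately show "p \<in> V \<times> V"
    using ext_props[of e r s e' s' r'] by (auto simp: garcs_iff gverts_def simp del: ext.simps)
qed

lemma garcs_irrefl: "(x, x) \<notin> E"
proof -
  obtain e s r where "x = (e, s, r)" by (metis surj_pair)
  then show ?thesis
    using ext_props[of e r s e s r] distinct_inner[of r] by (auto simp: garcs_iff simp del: ext.simps)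
qed

lemma garcs_Image: "x \<in> V \<Longrightarrow> E `` {x} = set (nbs as x)"
  by (auto simp: garcs_def)


lemma ext_step:
  assumes e: "e < m" and r: "r \<in> terminals" "ext as (e, s, r) = x"
  shows "((e, s, r), x) \<in> E"
  using assms by (cases x) (simp add: garcs_iff del: ext.simps)

lemma inner_step:
  assumes "e < m" "r' \<in> set (inner r)"
  shows "((e, s, r), (e, s, r')) \<in> E"
  using assms by (simp add: garcs_iff)

end

section \<open>The edges of a Hamiltonian cycle within one column\<close>

locale hamiltonian_factor = reduction +
  fixes H :: "(vertex \<times> vertex) set"
  assumes H_sym: "sym H" and H_E: "H \<subseteq> garcs as"
    and H_two: "x \<in> gverts as \<Longrightarrow> card (H `` {x}) = 2"
    and H_conn: "X \<subseteq> gverts as \<Longrightarrow> X \<noteq> {} \<Longrightarrow> H `` X \<subseteq> X \<Longrightarrow> X = gverts as"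
begin

definition h :: "nat \<Rightarrow> bool \<Rightarrow> role \<Rightarrow> role \<Rightarrow> bool" where
  "h e s r r' \<longleftrightarrow> ((e, s, r), (e, s, r')) \<in> H"

definition hx :: "nat \<Rightarrow> bool \<Rightarrow> role \<Rightarrow> bool" where
  "hx e s r \<longleftrightarrow> ((e, s, r), ext as (e, s, r)) \<in> H"

lemma H_symD: "(x, y) \<in> H \<Longrightarrow> (y, x) \<in> H"
  using H_sym by (rule symD)

lemma h_sym: "h e s r r' \<longleftrightarrow> h e s r' r"
  by (auto simp: h_def H_symD)

lemma hx_ext: "e < m \<Longrightarrow> r \<in> terminals \<Longrightarrow> ext as (e, s, r) = (e', s', r') \<Longrightarrow> hx e s r \<longleftrightarrow> hx e' s' r'"
  using ext_props[of e r s e' s' r'] H_symD by (auto simp: hx_def simp del: ext.simps)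

lemma two_of_three:
  assumes x: "x \<in> V" and nb: "nbs as x = [a, b, c]"
  shows "(x, a) \<in> H \<and> (x, b) \<in> H \<and> (x, c) \<notin> H \<or> (x, a) \<in> H \<and> (x, b) \<notin> H \<and> (x, c) \<in> H \<or>
    (x, a) \<notin> H \<and> (x, b) \<in> H \<and> (x, c) \<in> H"
proof -
  have d: "a \<noteq> b" "a \<noteq> c" "b \<noteq> c"
    using distinct_nbs[of "fst x" "fst (snd x)" "snd (snd x)"] x nb by (auto simp: gverts_def)
  have "H `` {x} \<subseteq> {a, b, c}"
    using H_E garcs_Image[OF x] nb by auto
  then have "H `` {x} = (if (x, a) \<in> H then {a} else {}) \<union> (if (x, b) \<in> H then {b} else {}) \<union> (if (x, c) \<in> H then {c} else {})"
    by auto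
  then show ?thesis using H_two[OF x] d by (auto split: if_splits)
qed

lemma terminal_degree:
  assumes "e < m" "r \<in> terminals" "inner r = [a, b]"
  shows "hx e s r \<and> h e s r a \<and> \<not> h e s r b \<or> hx e s r \<and> \<not> h e s r a \<and> h e s r b \<or>
    \<not> hx e s r \<and> h e s r a \<and> h e s r b"
  using two_of_three[of "(e, s, r)"] assms by (simp add: gverts_def hx_def h_def del: ext.simps)

lemma inner_degree:
  assumes "e < m" "r \<notin> terminals" "inner r = [a, b, c]"
  shows "h e s r a \<and> h e s r b \<and> \<not> h e s r c \<or> h e s r a \<and> \<not> h e s r b \<and> h e s r c \<or>
    \<not> h e s r a \<and> h e s r b \<and> h e s r c"
  using two_of_three[of "(e, s, r)"] assms by (simp add: gverts_def hx_def h_def del: ext.simps)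

text \<open>By connectivity a closed set would be the whole graph, but this one misses the port of
  its own column.\<close>

lemma not_closed:
  assumes e: "e < m" and r: "r \<in> R" "R \<inter> terminals = {}"
    and cl: "\<And>a b. a \<in> R \<Longrightarrow> b \<in> set (inner a) \<Longrightarrow> h e s a b \<Longrightarrow> b \<in> R"
  shows False
proof -
  let ?X = "(\<lambda>r. (e, s, r)) ` R"
  have "?X = V"
  proof (rule H_conn)
    show "?X \<subseteq> V" "?X \<noteq> {}" using e r by (auto simp: gverts_def)
    show "H `` ?X \<subseteq> ?X"
    proof
      fix y assume "y \<in> H `` ?X"
      then obtain a where a: "a \<in> R" "((e, s, a), y) \<in> H" by auto
      obtain e' s' b where y: "y = (e', s', b)" by (metis surj_pair)
      have "((e, s, a), y) \<in> E" using a H_E by auto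
      with a r have "e' = e" "s' = s" "b \<in> set (inner a)" by (auto simp: garcs_iff y)
      with a cl[of a b] show "y \<in> ?X" by (auto simp: y h_def)
    qed
  qed
  moreover have "(e, s, Pt) \<in> V" using e by (simp add: gverts_def)
  ultimately have "(e, s, Pt) \<in> ?X" by simp
  then have "Pt \<in> R" by auto
  then show False using r by (auto simp: terminals_def)
qed

text \<open>Only two edges leave the four vertices, and the degrees make a cycle use both or
  neither. Using neither would cut the diamond off from the rest.\<close>

lemma diamond_forced:
  assumes e: "e < m" and
    "inner a = [p, b, c]" "inner b = [a, c, d]" "inner c = [a, b, d]" "inner d = [b, c, q]"
    "{a, b, c, d} \<inter> terminals = {}" "p \<notin> {a, b, c, d}"
  shows "h e s p a \<and> h e s d q"
proof -
  note deg = inner_degree[OF e _ assms(2), of s] inner_degree[OF e _ assms(3), of s]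
    inner_degree[OF e _ assms(4), of s] inner_degree[OF e _ assms(5), of s]
  note sy = h_sym[of e s a p] h_sym[of e s a b] h_sym[of e s a c] h_sym[of e s b c] h_sym[of e s b d] h_sym[of e s c d]
  show ?thesis
  proof (cases "h e s p a")
    case True
    then show ?thesis using deg sy assms(6) by auto
  next
    case False
    then have "\<not> h e s d q" using deg sy assms(6) by auto
    with False have "y \<in> {a, b, c, d}" if "x \<in> {a, b, c, d}" "y \<in> set (inner x)" "h e s x y" for x y
      using that assms(2-5) sy(1) by (elim insertE) auto
    then show ?thesis
      using not_closed[OF e _ assms(6), of a s] by blast
  qed
qed

text \<open>The diamonds take one edge at each of \<open>Ca\<close> and \<open>Cb\<close>, which
  leaves each of them exactly one edge to \<open>LL\<close> or \<open>LR\<close>. As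
  \<open>LL\<close> and \<open>LR\<close> have one outer edge each, they need at least one of these
  two edges each, so they get one each and use their outer edges. On the upper rail
  \<open>Pt\<close> and \<open>UL\<close> each choose between the outer edge and \<open>UR\<close>,
  and the degree of \<open>UR\<close> couples the two choices.\<close>

lemma column_modes:
  assumes e: "e < m"
  shows "hx e s LL \<and> hx e s LR \<and> (if hx e s Pt then \<not> hx e s UL \<and> hx e s UR else hx e s UL = hx e s UR)"
proof -
  have f: "h e s Pt Da" "h e s Dd Ca" "h e s UL Ea" "h e s Ed Cb"
    using diamond_forced[OF e, of Da Pt Db Dc Dd Ca s] diamond_forced[OF e, of Ea UL Eb Ec Ed Cb s]
    by (auto simp: terminals_def)
  note sy = h_sym[of e s Dd Ca] h_sym[of e s Ed Cb] h_sym[of e s Pt UR] h_sym[of e s UL UR]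
    h_sym[of e s LL Ca] h_sym[of e s LL Cb] h_sym[of e s LR Ca] h_sym[of e s LR Cb]
  note dt = terminal_degree[OF e, of Pt UR Da s] terminal_degree[OF e, of UL UR Ea s]
    terminal_degree[OF e, of UR Pt UL s] terminal_degree[OF e, of LL Ca Cb s] terminal_degree[OF e, of LR Ca Cb s]
    inner_degree[OF e, of Ca Dd LL LR s] inner_degree[OF e, of Cb Ed LL LR s]
  show ?thesis
    using dt f sy by (simp add: terminals_def) argo
qed

end

section \<open>From the cubic graph to the digraph\<close>

text \<open>
  Applied to a line of columns from right to left, where \<open>p\<close>, \<open>u\<close> and \<open>w\<close> say that the port and the
  upper rails on the left and on the right are used.
\<close>

lemma strand_unique:
  assumes "cs \<noteq> []" "successively (\<lambda>c c'. u c = w c') cs"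
    and "\<And>c. c \<in> set cs \<Longrightarrow> if p c then \<not> u c \<and> w c else u c = w c"
  shows "if w (hd cs) \<and> \<not> u (last cs) then \<exists>!c. c \<in> set cs \<and> p c
    else (u (last cs) \<longrightarrow> w (hd cs)) \<and> (\<forall>c\<in>set cs. \<not> p c)"
  using assms
proof (induction cs rule: list_nonempty_induct)
  case (single x)
  then show ?case by (cases "p x") auto
next
  case (cons x xs)
  from cons.prems(1) cons.hyps have succ: "successively (\<lambda>c c'. u c = w c') xs"
    by (simp add: successively_Cons)
  have "if p c then \<not> u c \<and> w c else u c = w c" if "c \<in> set xs" for c
    by (rule cons.prems(2)) (use that in simp)
  note IH = cons.IH[OF succ this]
  have x: "if p x then \<not> u x \<and> w x else u x = w x" "u x = w (hd xs)"
    using cons.prems(2)[of x] cons.prems(1) cons.hyps by (auto simp: successively_Cons)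
  show ?case
  proof (cases "p x")
    case True
    \<comment> \<open>A used port leaves the rail dead on its left, and there it can neither revive
      nor serve another port.\<close>
    with x IH have "\<forall>c\<in>set xs. \<not> p c" "\<not> u (last xs)" by auto
    with True x cons.hyps show ?thesis by auto
  next
    case False
    then have "c \<in> set (x # xs) \<and> p c \<longleftrightarrow> c \<in> set xs \<and> p c" for c by auto
    with False x IH cons.hyps show ?thesis by (simp split: if_splits)
  qed
qed

lemma successively_snoc: "successively R (xs @ [c]) \<Longrightarrow> R c e \<Longrightarrow> successively R ((xs @ [c]) @ [e])"
  unfolding successively_append_iff[of _ "xs @ [c]"] by simp

context reduction
begin

text \<open>Connectivity of the cycle is applied to sets of this form, in order to obtain
  connectivity in the digraph.\<close>

definition block :: "nat set \<Rightarrow> vertex set" where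
  "block S = {(e, s, r). e < m \<and> key as s e \<in> S}"

lemma block_full: "block S = V \<Longrightarrow> S \<subseteq> {..<n} \<Longrightarrow> S = {..<n}"
proof (intro equalityI subsetI)
  fix v assume *: "block S = V" "v \<in> {..<n}"
  then obtain e where "e < m" "key as False e = v" using key_surj by blast
  then have "(e, False, Pt) \<in> block S" using * by (simp add: gverts_def)
  then show "v \<in> S" using \<open>key as False e = v\<close> by (simp add: block_def)
qed auto

text \<open>Inner edges, rails and the joints of lines all stay at one vertex of the
  digraph.\<close>

lemma edge_block:
  assumes "(x, y) \<in> E" "x \<in> block S"
  shows "y \<in> block S \<or> (\<exists>e s. x = (e, s, Pt) \<and> y = (e, \<not> s, Pt))"
proof -
  obtain e s r e' s' r' where x: "x = (e, s, r)" and y: "y = (e', s', r')" by (metis surj_pair)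
  consider "e' = e" "s' = s" | "r \<in> terminals" "ext as (e, s, r) = (e', s', r')"
    using assms by (auto simp: x y garcs_iff simp del: ext.simps)
  then show ?thesis
  proof cases
    case 2
    show ?thesis
    proof (cases "r = Pt")
      case True
      with 2 have "y = (e, \<not> s, Pt)" by (simp add: y)
      then show ?thesis using True x by blast
    next
      case False
      with assms ext_props[OF _ 2] show ?thesis by (simp add: x y block_def del: ext.simps)
    qed
  qed (use assms x y in \<open>auto simp: block_def\<close>)
qed

text \<open>Stated through \<open>before\<close> because the upper edge between the two columns is
  then \<open>ext\<close> at \<open>UR\<close> of the left one, \<open>c'\<close>.\<close>

definition linked :: "bool \<Rightarrow> nat \<Rightarrow> nat \<Rightarrow> bool" where
  "linked s c c' \<longleftrightarrow> before as s c' \<noteq> [] \<and> last (before as s c') = c \<and> c' < m"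

lemma cols_successive:
  assumes "v < n"
  shows "successively (linked s) (cols as s v)"
proof -
  have "successively (linked s) (before as s e @ [e])" if "e < m" for e
    using that
  proof (induction "before as s e" arbitrary: e rule: rev_induct)
    case Nil
    then show ?case by (metis append_Nil successively.simps(2))
  next
    case (snoc c xs)
    note c = before_snoc[OF snoc(2)[symmetric] snoc(3)]
    from snoc(1)[of c] c snoc(3) have "successively (linked s) (xs @ [c])"
      by simp
    moreover have "linked s c e"
      unfolding linked_def snoc(2)[symmetric] using snoc(3) by simp
    ultimately show ?case
      unfolding snoc(2)[symmetric] by (rule successively_snoc)
  qed
  from this[of "last (cols as s v)"] show ?thesis
    using last_cols[OF assms, of s] cols_split[of "last (cols as s v)" s] after_last_cols[OF assms, of s] by simp
qed

lemma before_hd_cols: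
  assumes "v < n"
  shows "before as s (hd (cols as s v)) = []"
proof -
  have c: "hd (cols as s v) \<in> set (cols as s v)" using cols_nonempty[OF assms] by simp
  then have "hd (cols as s v) < m" "key as s (hd (cols as s v)) = v" by (simp_all add: in_cols)
  then have "cols as s v = before as s (hd (cols as s v)) @ hd (cols as s v) # after as s (hd (cols as s v))"
    using cols_split by metis
  moreover have "hd (cols as s v) \<notin> set (before as s (hd (cols as s v)))" by (simp add: before_def)
  ultimately show ?thesis by (metis hd_append2 hd_in_set)
qed

end

context hamiltonian_factor
begin

definition used :: "nat \<Rightarrow> bool" where
  "used e \<longleftrightarrow> hx e False Pt"

lemma used_iff: "e < m \<Longrightarrow> hx e s Pt \<longleftrightarrow> used e"
  using hx_ext[of e Pt True e False Pt] by (cases s) (auto simp: used_def terminals_def)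

text \<open>Since only ports lead out of a block, closure under the used arcs in both directions
  makes the block closed under the cycle.\<close>

lemma block_closed:
  assumes S: "S \<subseteq> {..<n}" "S \<noteq> {}"
    and cl: "\<And>e s. e < m \<Longrightarrow> used e \<Longrightarrow> key as s e \<in> S \<Longrightarrow> key as (\<not> s) e \<in> S"
  shows "S = {..<n}"
proof -
  have "block S = V"
  proof (rule H_conn)
    show "block S \<subseteq> V" by (auto simp: block_def gverts_def)
    obtain v where "v \<in> S" using S by blast
    then show "block S \<noteq> {}" using S key_surj[of v False] by (force simp: block_def)
    show "H `` block S \<subseteq> block S"
    proof
      fix y assume "y \<in> H `` block S"
      then obtain x where x: "x \<in> block S" "(x, y) \<in> H" by auto
      with H_E edge_block[of x y S] have "y \<in> block S \<or> (\<exists>e s. x = (e, s, Pt) \<and> y = (e, \<not> s, Pt))" by blast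
      then show "y \<in> block S"
      proof (elim disjE exE conjE)
        fix e s assume eq: "x = (e, s, Pt)" "y = (e, \<not> s, Pt)"
        with x have "e < m" "hx e s Pt" "key as s e \<in> S" by (auto simp: block_def hx_def)
        with cl[of e s] eq show ?thesis by (auto simp: used_iff block_def)
      qed
    qed
  qed
  then show ?thesis using S(1) by (rule block_full)
qed

text \<open>In each line either exactly one port is used or the signal reaches the left end. The
  joint of the two lines makes the latter happen on both sides at once; then no arc at
  \<open>v\<close> is used, so the block of \<open>v\<close> is closed and \<open>v\<close> is the
  only vertex. But there is an arc at \<open>v\<close>, and it is not a loop.\<close>

lemma used_unique:
  assumes v: "v < n"
  shows "\<exists>!e. e < m \<and> key as s e = v \<and> used e"
proof -
  have chain: "if \<not> hx (last (cols as s v)) s UL then \<exists>!c. c \<in> set (cols as s v) \<and> hx c s Pt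
    else (\<forall>c\<in>set (cols as s v). \<not> hx c s Pt)" for s
  proof -
    let ?cs = "cols as s v"
    have hd: "hd ?cs < m" using cols_nonempty[OF v, of s] in_cols[of "hd ?cs" s v] by simp
    have "hx (hd ?cs) s UR \<longleftrightarrow> hx (hd ?cs) s LR"
      using hx_ext[OF hd, of UR s "hd ?cs" s LR] before_hd_cols[OF v, of s] by (simp add: terminals_def)
    \<comment> \<open>The joint at the right end passes the use of the lower rail, which is certain,
      on to the upper rail.\<close>
    then have hd_used: "hx (hd ?cs) s UR" using column_modes[OF hd, of s] by simp
    have succ: "successively (\<lambda>c c'. hx c s UL = hx c' s UR) ?cs"
      by (rule successively_mono[OF cols_successive[OF v, of s]])
        (use hx_ext[of _ UR s] in \<open>auto simp: linked_def terminals_def\<close>)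
    have modes: "if hx c s Pt then \<not> hx c s UL \<and> hx c s UR else hx c s UL = hx c s UR" if "c \<in> set ?cs" for c
      using that column_modes[of c s] in_cols by blast
    from strand_unique[OF cols_nonempty[OF v] succ modes] hd_used show ?thesis
      by (cases "hx (last ?cs) s UL") simp_all
  qed
  have mid: "hx (last (cols as False v)) False UL \<longleftrightarrow> hx (last (cols as True v)) True UL"
    using hx_ext[of "last (cols as False v)" UL False "last (cols as True v)" True UL]
      last_cols[OF v, of False] after_last_cols[OF v, of False] by (simp add: terminals_def)
  have "\<not> hx (last (cols as s v)) s UL"
  proof
    assume "hx (last (cols as s v)) s UL"
    then have "hx (last (cols as s' v)) s' UL" for s'
      using mid by (cases s; cases s') simp_all
    then have "\<forall>c\<in>set (cols as s' v). \<not> hx c s' Pt" for s'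
      using chain[of s'] by simp
    then have "key as s e \<noteq> v" if "e < m" "used e" for e s
      using that in_cols used_iff by blast
    then have "key as (\<not> s) e \<in> {v}" if "e < m" "used e" "key as s e \<in> {v}" for e s
      using that by blast
    moreover have "{v} \<subseteq> {..<n}" "{v} \<noteq> {}" using v by simp_all
    ultimately have "{v} = {..<n}" by (rule block_closed[rotated 2])
    moreover obtain e where e: "e < m" "key as False e = v" using key_surj[OF v] by blast
    moreover have "key as True e \<in> {..<n}" using key_lt[OF e(1)] by simp
    ultimately have "key as True e = v" by blast
    then show False using key_neq[OF e(1), of False] e(2) by simp
  qed
  with chain[of s] have "\<exists>!c. c \<in> set (cols as s v) \<and> hx c s Pt" by simp
  moreover have "c \<in> set (cols as s v) \<and> hx c s Pt \<longleftrightarrow> c < m \<and> key as s c = v \<and> used c" for c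
    using in_cols used_iff by blast
  ultimately show ?thesis by simp
qed

text \<open>The used leaving arcs define a successor function \<open>\<sigma>\<close>, and the
  uniqueness of the used entering arcs makes it injective.\<close>

lemma digraph_ham: "\<exists>vs. ham (set as) {..<n} vs"
proof -
  define \<epsilon> where "\<epsilon> v = (THE e. e < m \<and> key as False e = v \<and> used e)" for v
  have \<epsilon>: "\<epsilon> v < m" "key as False (\<epsilon> v) = v" "used (\<epsilon> v)" if "v < n" for v
    using theI'[OF used_unique[OF that, of False]] by (simp_all add: \<epsilon>_def)
  have \<epsilon>_eq: "\<epsilon> (key as False e) = e" if "e < m" "used e" for e
    using that used_unique[OF key_lt[OF that(1), of False], of False] \<epsilon>[OF key_lt[OF that(1), of False]] by blast
  define \<sigma> where "\<sigma> v = key as True (\<epsilon> v)" for v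
  have inj: "inj_on \<sigma> {..<n}"
  proof (rule inj_onI)
    fix v w assume *: "v \<in> {..<n}" "w \<in> {..<n}" "\<sigma> v = \<sigma> w"
    then have vw: "v < n" "w < n" by simp_all
    have "\<sigma> v < n" using key_lt[OF \<epsilon>(1)[OF vw(1)]] by (simp add: \<sigma>_def)
    from ex1_implies_ex[OF used_unique[OF this, of True]] used_unique[OF this, of True]
    obtain a where a: "e = a" if "e < m" "key as True e = \<sigma> v" "used e" for e
      by metis
    have "\<epsilon> v = a" by (rule a[OF \<epsilon>(1)[OF vw(1)] _ \<epsilon>(3)[OF vw(1)]]) (simp add: \<sigma>_def)
    moreover have "\<epsilon> w = a" by (rule a[OF \<epsilon>(1)[OF vw(2)] _ \<epsilon>(3)[OF vw(2)]]) (use *(3) \<sigma>_def in metis)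
    ultimately have "\<epsilon> v = \<epsilon> w" by simp
    then show "v = w" using \<epsilon>(2)[OF vw(1)] \<epsilon>(2)[OF vw(2)] by metis
  qed
  show ?thesis
  proof (rule ham_of_permutation[of _ \<sigma>])
    fix v assume v: "v \<in> {..<n}"
    then have "as ! \<epsilon> v = (v, \<sigma> v)" using \<epsilon>[of v] by (auto simp: \<sigma>_def key_def prod_eq_iff)
    with v show "\<sigma> v \<in> {..<n} \<and> (v, \<sigma> v) \<in> set as"
      using \<epsilon>[of v] key_lt[of "\<epsilon> v" True] by (auto simp: \<sigma>_def) (metis nth_mem)
  next
    fix X assume X: "X \<subseteq> {..<n}" "X \<noteq> {}" "\<sigma> ` X \<subseteq> X"
    \<comment> \<open>\<open>block_closed\<close> asks for closure along used arcs in both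
      directions. Since \<open>X\<close> is finite and \<open>\<sigma>\<close> injective, closure
      under \<open>\<sigma>\<close> yields closure under its inverse.\<close>
    have "finite X" using X finite_subset by blast
    then have surj: "\<sigma> ` X = X"
      using X inj by (metis card_image card_subset_eq inj_on_subset)
    show "X = {..<n}"
    proof (rule block_closed[OF X(1,2)])
      fix e s assume e: "e < m" "used e" "key as s e \<in> X"
      then have s: "\<sigma> (key as False e) = key as True e" by (simp add: \<sigma>_def \<epsilon>_eq)
      show "key as (\<not> s) e \<in> X"
      proof (cases s)
        case False
        have "\<sigma> (key as False e) \<in> X" using e(3) False X(3) by auto
        with s False show ?thesis by simp
      next
        case True
        then have "key as True e \<in> \<sigma> ` X" using e(3) surj by simp
        then obtain v where v: "v \<in> X" "key as True e = \<sigma> v" by blast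
        have "v = key as False e"
          by (rule inj_onD[OF inj]) (use s v X key_lt[OF e(1)] in auto)
        with True v show ?thesis by simp
      qed
    qed
  qed (use pos in auto)
qed

end

context reduction
begin

lemma ham_from_gadgets:
  assumes "ham E V vs" "3 \<le> length vs"
  shows "\<exists>vs. ham (set as) {..<n} vs"
proof -
  obtain H where "sym H" "H \<subseteq> E" "\<forall>x\<in>V. card (H `` {x}) = 2"
    "\<forall>X\<subseteq>V. X \<noteq> {} \<longrightarrow> H `` X \<subseteq> X \<longrightarrow> X = V"
    using ham_two_regular[OF assms garcs_sym] by blast
  then interpret hamiltonian_factor n as H
    by unfold_locales auto
  show ?thesis by (rule digraph_ham)
qed

end

section \<open>From the digraph to the cubic graph\<close>

definition row :: "bool \<Rightarrow> role list \<Rightarrow> nat \<Rightarrow> vertex list" where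
  "row s rs e = map (\<lambda>r. (e, s, r)) rs"

text \<open>
  Entering a line at the port of \<open>e\<close>, a Hamiltonian path first runs to the right end and back, the
  two strands swapping rails at each column, and then sweeps the columns on the left of \<open>e\<close>.
\<close>

fun loop :: "bool \<Rightarrow> bool \<Rightarrow> nat list \<Rightarrow> vertex list" where
  "loop s t [] = []"
| "loop s t (c # cs) = (if t
     then row s [LL, Ca, Dd, Dc, Db, Da, Pt, UR] c @ loop s False cs @ row s [LR, Cb, Ed, Ec, Eb, Ea, UL] c
     else row s [UL, Ea, Eb, Ec, Ed, Cb, LR] c @ loop s True cs @ row s [UR, Pt, Da, Db, Dc, Dd, Ca, LL] c)"

definition half :: "(nat \<times> nat) list \<Rightarrow> bool \<Rightarrow> nat \<Rightarrow> vertex list" where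
  "half as s e = row s [Pt, Da, Db, Dc, Dd, Ca, LR] e @ loop s True (rev (before as s e)) @
     row s [UR, UL, Ea, Eb, Ec, Ed, Cb, LL] e @
     concat (map (row s [LR, Ca, Dd, Dc, Db, Da, Pt, UR, UL, Ea, Eb, Ec, Ed, Cb, LL]) (after as s e))"

text \<open>One segment per arc of the cycle, from the left end of the leaving line of its tail
  through the two ports to the left end of the entering line of its head.\<close>

definition seg :: "(nat \<times> nat) list \<Rightarrow> nat \<Rightarrow> vertex list" where
  "seg as e = rev (half as False e) @ half as True e"

lemma set_row: "set (row s rs e) = {e} \<times> {s} \<times> set rs"
  by (auto simp: row_def)

lemma distinct_row: "distinct (row s rs e) \<longleftrightarrow> distinct rs"
  by (simp add: row_def distinct_map inj_on_def)

lemma UNIV_role: "UNIV = {LL, Ca, Dd, Dc, Db, Da, Pt, UR, LR, Cb, Ed, Ec, Eb, Ea, UL}"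
proof (rule set_eqI)
  fix r :: role
  show "r \<in> UNIV \<longleftrightarrow> r \<in> {LL, Ca, Dd, Dc, Db, Da, Pt, UR, LR, Cb, Ed, Ec, Eb, Ea, UL}"
    by (cases r) simp_all
qed

lemma set_loop: "set (loop s t cs) = set cs \<times> {s} \<times> UNIV"
  unfolding UNIV_role by (induction cs arbitrary: t) (auto simp: set_row)

lemma distinct_loop: "distinct cs \<Longrightarrow> distinct (loop s t cs)"
  by (induction cs arbitrary: t) (auto simp: set_row distinct_row set_loop)

context reduction
begin

abbreviation "step \<equiv> \<lambda>x y. (x, y) \<in> E"

lemma step_sym: "step x y \<longleftrightarrow> step y x"
  using symD[OF garcs_sym] by blast

text \<open>Both values of \<open>t\<close> are needed in the induction because the strands change
  rails at every column. In the rightmost column they are joined by the edge between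
  \<open>UR\<close> and \<open>LR\<close>.\<close>

lemma loop_path:
  assumes "before as s c = rev cs" "c < m"
  shows "successively step (loop s t (c # cs)) \<and> hd (loop s t (c # cs)) = (c, s, if t then LL else UL) \<and>
    last (loop s t (c # cs)) = (c, s, if t then UL else LL)"
  using assms
proof (induction cs arbitrary: c t)
  case Nil
  then show ?case
    using ext_step[of c UR s "(c, s, LR)"] ext_step[of c LR s "(c, s, UR)"]
    by (cases t) (simp_all add: row_def inner_step terminals_def)
next
  case (Cons d cs)
  then have d: "before as s d = rev cs" "d < m"
    using before_snoc[of s c "rev cs" d] by auto
  note IH = Cons.IH[OF d, of True] Cons.IH[OF d, of False]
  have "step (c, s, UR) (d, s, UL)" "step (c, s, LR) (d, s, LL)"
    using ext_step[of c UR s "(d, s, UL)"] ext_step[of c LR s "(d, s, LL)"] Cons.prems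
    by (simp_all add: terminals_def)
  moreover from this have "step (d, s, UL) (c, s, UR)" "step (d, s, LL) (c, s, LR)"
    by (simp_all add: step_sym)
  moreover have "loop s t' (d # cs) \<noteq> []" for t' by (simp add: row_def)
  ultimately show ?case
    using IH Cons.prems(2)
    by (cases t) (simp_all add: loop.simps(2)[of s _ c] row_def inner_step successively_append_iff successively_Cons
      del: loop.simps)
qed

text \<open>A column on the left of the used one is swept in a single pass from \<open>LR\<close> to
  \<open>LL\<close>. Starting with \<open>LL\<close> of \<open>c\<close> puts the edge to the next
  column into the statement, as the induction requires.\<close>

lemma tail_path:
  assumes "after as s c = cs" "c < m"
  defines "ps \<equiv> (c, s, LL) # concat (map (row s [LR, Ca, Dd, Dc, Db, Da, Pt, UR, UL, Ea, Eb, Ec, Ed, Cb, LL]) cs)"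
  shows "successively step ps \<and> last ps = (last (cols as s (key as s c)), s, LL)"
  using assms(1,2) unfolding ps_def
proof (induction cs arbitrary: c)
  case Nil
  then show ?case by (simp add: last_cols_eq)
next
  case (Cons d cs)
  note d = after_Cons[OF Cons.prems]
  have "step (c, s, LL) (d, s, LR)"
    using ext_step[of c LL s "(d, s, LR)"] Cons.prems by (simp add: terminals_def)
  then show ?case
    using Cons.IH[of d] d by (simp add: row_def inner_step successively_append_iff)
qed

lemma half_path:
  assumes e: "e < m"
  shows "successively step (half as s e) \<and> hd (half as s e) = (e, s, Pt) \<and>
    last (half as s e) = (last (cols as s (key as s e)), s, LL)"
proof -
  let ?A = "row s [Pt, Da, Db, Dc, Dd, Ca, LR] e" and ?B = "row s [UR, UL, Ea, Eb, Ec, Ed, Cb] e"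
    and ?L = "loop s True (rev (before as s e))"
    and ?T = "(e, s, LL) # concat (map (row s [LR, Ca, Dd, Dc, Db, Da, Pt, UR, UL, Ea, Eb, Ec, Ed, Cb, LL]) (after as s e))"
  \<comment> \<open>The last vertex \<open>LL\<close> of the second visit to \<open>e\<close> is
    moved into \<open>?T\<close>, where \<open>tail_path\<close> expects it.\<close>
  have half: "half as s e = (?A @ ?L) @ ?B @ ?T"
    by (simp add: half_def row_def)
  have mid: "successively step (?A @ ?L) \<and> step (last (?A @ ?L)) (e, s, UR)"
  proof (cases "rev (before as s e)")
    case Nil
    then show ?thesis
      using e ext_step[of e LR s "(e, s, UR)"] by (simp add: row_def inner_step terminals_def)
  next
    case (Cons d cs)
    then have b: "before as s e = rev cs @ [d]" by (simp add: rev_swap)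
    have "step (e, s, LR) (d, s, LL)" "step (e, s, UR) (d, s, UL)"
      using ext_step[of e UR s "(d, s, UL)"] ext_step[of e LR s "(d, s, LL)"] b e
      by (simp_all add: terminals_def)
    moreover have "step (d, s, UL) (e, s, UR)" using calculation by (simp add: step_sym)
    moreover have "before as s d = rev cs" "d < m" using before_snoc[OF b e] e by auto
    moreover have "loop s True (d # cs) \<noteq> []" by (simp add: row_def)
    ultimately show ?thesis
      using loop_path[of s d cs True] e unfolding Cons
      by (simp add: row_def inner_step successively_append_iff successively_Cons del: loop.simps)
  qed
  moreover have "successively step (?B @ ?T)" "hd (?B @ ?T) = (e, s, UR)"
    "last (?B @ ?T) = (last (cols as s (key as s e)), s, LL)"
    using tail_path[OF refl e, of s] e by (auto simp: row_def inner_step successively_append_iff)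
  ultimately show ?thesis
    unfolding half successively_append_iff[of _ "?A @ ?L"] by (simp add: row_def)
qed

lemma half_set:
  assumes e: "e < m"
  shows "set (half as s e) = set (cols as s (key as s e)) \<times> {s} \<times> UNIV" "distinct (half as s e)"
proof -
  have c: "cols as s (key as s e) = before as s e @ e # after as s e" by (rule cols_split[OF e])
  show "set (half as s e) = set (cols as s (key as s e)) \<times> {s} \<times> UNIV"
  proof -
    have join: "{e} \<times> {s} \<times> A \<union> (set xs \<times> {s} \<times> UNIV \<union> ({e} \<times> {s} \<times> C \<union> (\<Union>x\<in>set ys. {x} \<times> {s} \<times> UNIV))) =
      set (xs @ e # ys) \<times> {s} \<times> UNIV" if "A \<union> C = UNIV" for A C :: "role set" and xs ys
      using that by auto
    have "set [Pt, Da, Db, Dc, Dd, Ca, LR] \<union> set [UR, UL, Ea, Eb, Ec, Ed, Cb, LL] = UNIV"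
      "set [LR, Ca, Dd, Dc, Db, Da, Pt, UR, UL, Ea, Eb, Ec, Ed, Cb, LL] = UNIV"
      unfolding UNIV_role by auto
    then show ?thesis
      unfolding half_def c set_append set_loop set_concat set_map image_image set_row set_rev
      by (simp only: join set_append)
  qed
  have d: "distinct (before as s e @ e # after as s e)"
    unfolding c[symmetric] by (simp add: cols_def)
  have "distinct (concat (map (row s [LR, Ca, Dd, Dc, Db, Da, Pt, UR, UL, Ea, Eb, Ec, Ed, Cb, LL]) cs))"
    if "distinct cs" for cs
    using that by (induction cs) (auto simp: distinct_row set_row)
  with d show "distinct (half as s e)"
    unfolding half_def by (auto simp: set_loop set_row distinct_row distinct_loop)
qed

text \<open>Columns are named by positions in the list of arcs, so the cycle is rewritten as the
  list of positions of its arcs.\<close>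

lemma arc_indices:
  assumes "vs \<noteq> []" "successively (\<lambda>x y. (x, y) \<in> set as) (vs @ [w])"
  shows "\<exists>es. map (key as False) es = vs \<and> set es \<subseteq> {..<m} \<and>
    successively (\<lambda>e e'. key as True e = key as False e') es \<and> key as True (last es) = w"
  using assms
proof (induction vs)
  case (Cons v vs)
  have "(v, hd (vs @ [w])) \<in> set as" using Cons.prems by (cases vs) auto
  then obtain e where e: "e < m" "key as False e = v" "key as True e = hd (vs @ [w])"
    by (auto simp: in_set_conv_nth key_def)
  show ?case
  proof (cases "vs = []")
    case True
    with e show ?thesis by (intro exI[of _ "[e]"]) simp
  next
    case False
    with Cons obtain es where es: "map (key as False) es = vs" "set es \<subseteq> {..<m}"
      "successively (\<lambda>e e'. key as True e = key as False e') es" "key as True (last es) = w"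
      by (auto simp: successively_Cons)
    moreover from this False have "es \<noteq> []" by auto
    ultimately show ?thesis using e False
      by (intro exI[of _ "e # es"]) (auto simp: successively_Cons hd_map)
  qed
qed simp

lemma seg_path:
  assumes e: "e < m"
  shows "seg as e \<noteq> []" "successively step (seg as e)"
    "hd (seg as e) = (last (cols as False (key as False e)), False, LL)"
    "last (seg as e) = (last (cols as True (key as True e)), True, LL)"
proof -
  have ne: "half as s e \<noteq> []" for s by (simp add: half_def row_def)
  then show "seg as e \<noteq> []" by (simp add: seg_def)
  have "step (e, False, Pt) (e, True, Pt)"
    using ext_step[OF e, of Pt False] by (simp add: terminals_def)
  then show "successively step (seg as e)"
    using half_path[OF e, of False] half_path[OF e, of True] ne
    by (simp add: seg_def successively_append_iff successively_rev last_rev step_sym)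
  show "hd (seg as e) = (last (cols as False (key as False e)), False, LL)"
    using half_path[OF e, of False] ne by (simp add: seg_def hd_rev)
  show "last (seg as e) = (last (cols as True (key as True e)), True, LL)"
    using half_path[OF e, of True] ne by (simp add: seg_def)
qed

text \<open>Consecutive segments meet at the lower edge between the two lines of the common vertex;
  the cycle avoids the upper one.\<close>

lemma seg_link:
  assumes "e < m" "e' < m" "key as True e = key as False e'"
  shows "step (last (seg as e)) (hd (seg as e'))"
proof -
  define v where "v = key as True e"
  have v: "v < n" "key as False e' = v" "key as True e = v" using assms key_lt by (auto simp: v_def)
  then show ?thesis
    using ext_step[of "last (cols as True v)" LL True "(last (cols as False v), False, LL)"]
      last_cols[OF v(1), of True] after_last_cols[OF v(1), of True]
    by (simp add: seg_path assms terminals_def)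
qed

lemma segs_path:
  assumes "successively (\<lambda>e e'. key as True e = key as False e') es" "set es \<subseteq> {..<m}" "es \<noteq> []"
  shows "successively step (concat (map (seg as) es)) \<and> hd (concat (map (seg as) es)) = hd (seg as (hd es)) \<and>
    last (concat (map (seg as) es)) = last (seg as (last es)) \<and> concat (map (seg as) es) \<noteq> []"
  using assms
proof (induction es)
  case (Cons e es)
  show ?case
  proof (cases "es = []")
    case True
    with Cons.prems show ?thesis by (simp add: seg_path)
  next
    case False
    have e: "e < m" "hd es < m" using Cons.prems hd_in_set[OF False] by auto
    have "step (last (seg as e)) (hd (seg as (hd es)))"
      using Cons.prems False e by (intro seg_link) (auto simp: successively_Cons)
    then show ?thesis
      using Cons False e by (auto simp: successively_Cons successively_append_iff seg_path)
  qed
qed simp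

lemma gadgets_from_ham:
  assumes "ham (set as) {..<n} vs"
  shows "\<exists>ws. ham E V ws \<and> 3 \<le> length ws"
proof -
  obtain es where es: "map (key as False) es = vs" "set es \<subseteq> {..<m}"
    "successively (\<lambda>e e'. key as True e = key as False e') es" "key as True (last es) = hd vs"
    using arc_indices[of vs "hd vs"] assms by (auto simp: ham_def)
  define ws where "ws = concat (map (seg as) es)"
  have ne: "es \<noteq> []" and vs: "distinct vs" "set vs = {..<n}" using es assms by (auto simp: ham_def)
  have m: "e < m" if "e \<in> set es" for e using that es by auto
  \<comment> \<open>The heads are the tails rotated by one place, so they too meet every vertex
    once. Hence the segments cover every line on either side exactly once.\<close>
  have heads: "map (key as True) es = tl vs @ [hd vs]"
    using es(1,3,4) ne
  proof -
    have "map (key as True) es = tl (map (key as False) es) @ [key as True (last es)]"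
      using es(3) ne by (induction es) (auto simp: successively_Cons neq_Nil_conv)
    then show ?thesis using es by simp
  qed
  have vs': "distinct (tl vs @ [hd vs])" "set (tl vs @ [hd vs]) = {..<n}"
    using vs ne es(1) by (cases vs; auto)+
  have key_inj: "key as s e = key as s e' \<Longrightarrow> e = e'" if "e \<in> set es" "e' \<in> set es" for e e' s
  proof -
    have "distinct (map (key as s) es)" using vs vs' es heads by (cases s) auto
    then show "key as s e = key as s e' \<Longrightarrow> e = e'" using that by (auto simp: distinct_map inj_on_def)
  qed
  have key_set: "key as s ` set es = {..<n}" for s
  proof -
    have "set (map (key as s) es) = {..<n}"
      using vs(2) vs'(2) arg_cong[OF es(1), of set] arg_cong[OF heads, of set] by (cases s) simp_all
    then show ?thesis by simp
  qed
  have seg_set: "set (seg as e) = {(c, s, r). c < m \<and> key as s c = key as s e}" if "e < m" for e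
  proof (intro set_eqI)
    fix x :: vertex
    obtain c s r where x: "x = (c, s, r)" by (metis surj_pair)
    show "x \<in> set (seg as e) \<longleftrightarrow> x \<in> {(c, s, r). c < m \<and> key as s c = key as s e}"
      using that by (cases s) (simp_all add: x seg_def half_set in_cols)
  qed
  have "distinct ws"
    unfolding ws_def
  proof (rule distinct_concat)
    have "inj_on (seg as) (set es)"
    proof (rule inj_onI)
      fix e e' assume *: "e \<in> set es" "e' \<in> set es" "seg as e = seg as e'"
      then have "(e, False, Pt) \<in> set (seg as e')" using seg_set[OF m[of e]] m[of e] by force
      then show "e = e'" using * seg_set[OF m[of e']] key_inj by force
    qed
    moreover have "distinct es" using vs(1) es(1) by (metis distinct_map)
    ultimately show "distinct (map (seg as) es)" by (simp add: distinct_map)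
    show "distinct xs" if "xs \<in> set (map (seg as) es)" for xs
      using that m half_set by (auto simp: seg_def)
    show "set xs \<inter> set ys = {}" if "xs \<in> set (map (seg as) es)" "ys \<in> set (map (seg as) es)" "xs \<noteq> ys" for xs ys
      using that seg_set m key_inj by (auto; metis)
  qed
  moreover have "set ws = V"
  proof (intro equalityI subsetI)
    fix x assume "x \<in> V"
    then obtain c s r where x: "x = (c, s, r)" "c < m" by (auto simp: gverts_def)
    then have "key as s c \<in> key as s ` set es" using key_set key_lt by simp
    then obtain e where "e \<in> set es" "key as s c = key as s e" by auto
    then show "x \<in> set ws" using x seg_set m by (auto simp: ws_def)
  qed (use seg_set m in \<open>auto simp: ws_def gverts_def\<close>)
  moreover have path: "successively step ws" "hd ws = hd (seg as (hd es))" "last ws = last (seg as (last es))" "ws \<noteq> []"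
    using segs_path[OF es(3,2) ne] by (auto simp: ws_def)
  moreover have "step (last ws) (hd ws)"
    unfolding path using ne m es(1,4) by (intro seg_link) (auto simp: hd_map)
  moreover have "3 \<le> length ws"
  proof -
    have len: "15 \<le> length (seg as e)" for e by (simp add: seg_def half_def row_def)
    obtain e es' where "es = e # es'" using ne by (cases es) auto
    then show ?thesis using len[of e] by (simp add: ws_def)
  qed
  ultimately show ?thesis
    by (intro exI[of _ ws]) (simp add: ham_def successively_append_iff)
qed

end

section \<open>Total correctness with a time bound\<close>

text \<open>
  If all numbers in memory are at most \<open>B\<close> and every loop makes at most \<open>R\<close> iterations, then the
  running time is bounded by \<open>budget\<close>; thus it suffices to keep track of these two bounds.
\<close>

definition bnd :: "nat \<Rightarrow> state \<Rightarrow> bool" where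
  "bnd B s \<longleftrightarrow> (\<forall>a i. s a i \<le> B)"

text \<open>A constant counts with its value because constants of the program text need not lie
  below \<open>B\<close>.\<close>

fun weight :: "exp \<Rightarrow> nat" where
  "weight (Const n) = 1 + n"
| "weight (Cell a e) = weight e + 1"
| "weight (Plus e1 e2) = weight e1 + weight e2 + 1"
| "weight (Minus e1 e2) = weight e1 + weight e2 + 1"

fun work :: "com \<Rightarrow> nat" where
  "work Skip = 1"
| "work (Assign a i e) = 1 + weight i ^ 2 + weight e ^ 2"
| "work (Seq c1 c2) = work c1 + work c2"
| "work (If b c1 c2) = 1 + weight b ^ 2 + work c1 + work c2"
| "work (While b c) = 1 + weight b ^ 2 + work c"

fun depth :: "com \<Rightarrow> nat" where
  "depth Skip = 0"
| "depth (Assign a i e) = 0"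
| "depth (Seq c1 c2) = max (depth c1) (depth c2)"
| "depth (If b c1 c2) = max (depth c1) (depth c2)"
| "depth (While b c) = Suc (depth c)"

lemma floorlog_le: "floorlog 2 n \<le> n"
proof (cases "n = 0")
  case False
  then show ?thesis
    by (intro floorlog_leI) (auto simp: less_exp)
qed (simp add: floorlog_def)

lemma val_bound: "bnd B s \<Longrightarrow> val e s \<le> weight e * (B + 1)"
proof (induction e)
  case (Cell a e)
  then have "s a (val e s) \<le> B" by (simp add: bnd_def)
  also have "B \<le> weight (Cell a e) * (B + 1)" by simp
  finally show ?case by simp
qed (auto simp: algebra_simps intro: order_trans[OF diff_le_self])

text \<open>Every node of the expression is charged at most a value bound, which by
  \<open>val_bound\<close> is linear in the weight; summing over the nodes gives the square.
  Estimating \<open>floorlog 2 n\<close> by \<open>n\<close> is crude but still polynomial.\<close>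

lemma cost_bound: "bnd B s \<Longrightarrow> cost e s \<le> weight e ^ 2 * (B + 1)"
proof (induction e)
  case (Const n)
  have "1 + floorlog 2 n \<le> (1 + n) * 1" using floorlog_le[of n] by simp
  also have "\<dots> \<le> (1 + n) * ((1 + n) * (B + 1))" by (intro mult_left_mono) auto
  finally show ?case by (simp only: cost.simps weight.simps power2_eq_square mult.assoc)
next
  case (Cell a e)
  then have "s a (val e s) \<le> B" by (simp add: bnd_def)
  then have "cost (Cell a e) s \<le> weight e ^ 2 * (B + 1) + (B + 1)"
    using Cell floorlog_le[of "s a (val e s)"] by simp
  also have "\<dots> = (weight e ^ 2 + 1) * (B + 1)" by (simp add: algebra_simps)
  also have "\<dots> \<le> (weight e + 1) ^ 2 * (B + 1)"
    by (intro mult_right_mono) (auto simp: power2_eq_square)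
  finally show ?case by simp
next
  case (Plus e1 e2)
  have "cost (Plus e1 e2) s \<le> weight e1 ^ 2 * (B + 1) + weight e2 ^ 2 * (B + 1) + 1 + (weight e1 * (B + 1) + weight e2 * (B + 1))"
    using Plus val_bound[OF Plus.prems, of e1] val_bound[OF Plus.prems, of e2]
      floorlog_le[of "val e1 s + val e2 s"] by simp
  also have "\<dots> \<le> (weight e1 ^ 2 + weight e2 ^ 2 + 1 + (weight e1 + weight e2)) * (B + 1)"
    by (simp add: algebra_simps)
  also have "\<dots> \<le> (weight e1 + weight e2 + 1) ^ 2 * (B + 1)"
    by (intro mult_right_mono) (auto simp: power2_eq_square algebra_simps)
  finally show ?case by simp
next
  case (Minus e1 e2)
  have "cost (Minus e1 e2) s \<le> weight e1 ^ 2 * (B + 1) + weight e2 ^ 2 * (B + 1) + 1 + (weight e1 * (B + 1) + weight e2 * (B + 1))"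
    using Minus val_bound[OF Minus.prems, of e1] val_bound[OF Minus.prems, of e2]
      floorlog_le[of "val e1 s - val e2 s"] by simp
  also have "\<dots> \<le> (weight e1 ^ 2 + weight e2 ^ 2 + 1 + (weight e1 + weight e2)) * (B + 1)"
    by (simp add: algebra_simps)
  also have "\<dots> \<le> (weight e1 + weight e2 + 1) ^ 2 * (B + 1)"
    by (intro mult_right_mono) (auto simp: power2_eq_square algebra_simps)
  finally show ?case by simp
qed

locale machine =
  fixes R B :: nat
begin

definition budget :: "com \<Rightarrow> nat" where
  "budget c = work c * (R + 1) ^ depth c * (B + 1)"

definition ht :: "(state \<Rightarrow> bool) \<Rightarrow> com \<Rightarrow> (state \<Rightarrow> bool) \<Rightarrow> bool" where
  "ht P c Q \<longleftrightarrow> (\<forall>s. P s \<and> bnd B s \<longrightarrow>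
     (\<exists>t s'. exec c s t s' \<and> t \<le> budget c \<and> Q s' \<and> bnd B s'))"

lemma htD: "ht P c Q \<Longrightarrow> P s \<Longrightarrow> bnd B s \<Longrightarrow> \<exists>t s'. exec c s t s' \<and> t \<le> budget c \<and> Q s' \<and> bnd B s'"
  by (auto simp: ht_def)

lemma ht_conseq:
  "ht P c Q \<Longrightarrow> (\<And>s. P' s \<Longrightarrow> bnd B s \<Longrightarrow> P s) \<Longrightarrow> (\<And>s. Q s \<Longrightarrow> bnd B s \<Longrightarrow> Q' s) \<Longrightarrow> ht P' c Q'"
  unfolding ht_def by meson

lemma ht_Skip: "ht P Skip P"
  unfolding ht_def budget_def by (force intro: exec.Skip)

lemma ht_Assign: "ht (\<lambda>s. val e s \<le> B \<and> P (s(a := (s a)(val i s := val e s)))) (Assign a i e) P"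
  unfolding ht_def
proof (intro allI impI)
  fix s assume s: "(val e s \<le> B \<and> P (s(a := (s a)(val i s := val e s)))) \<and> bnd B s"
  have "1 + cost i s + cost e s \<le> 1 * (B + 1) + weight i ^ 2 * (B + 1) + weight e ^ 2 * (B + 1)"
    using cost_bound[of B s i] cost_bound[of B s e] s by simp
  also have "\<dots> = budget (Assign a i e)" by (simp add: budget_def algebra_simps)
  finally have "1 + cost i s + cost e s \<le> budget (Assign a i e)" .
  moreover have "bnd B (s(a := (s a)(val i s := val e s)))" using s by (auto simp: bnd_def)
  ultimately show "\<exists>t s'. exec (Assign a i e) s t s' \<and> t \<le> budget (Assign a i e) \<and> P s' \<and> bnd B s'"
    using s exec.Assign by blast
qed

lemma budget_mono: "d \<le> depth c \<Longrightarrow> w * (R + 1) ^ d * (B + 1) \<le> w * (R + 1) ^ depth c * (B + 1)"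
  by (intro mult_right_mono mult_left_mono power_increasing) auto

lemma budget_Seq: "budget c1 + budget c2 \<le> budget (Seq c1 c2)"
proof -
  have "budget c1 + budget c2 \<le> work c1 * (R + 1) ^ depth (Seq c1 c2) * (B + 1) + work c2 * (R + 1) ^ depth (Seq c1 c2) * (B + 1)"
    unfolding budget_def by (intro add_mono budget_mono) auto
  then show ?thesis by (simp add: budget_def algebra_simps)
qed

lemma ht_Seq: "ht P c1 Q \<Longrightarrow> ht Q c2 S \<Longrightarrow> ht P (Seq c1 c2) S"
  unfolding ht_def
proof (intro allI impI)
  fix s assume a: "\<forall>s. P s \<and> bnd B s \<longrightarrow> (\<exists>t s'. exec c1 s t s' \<and> t \<le> budget c1 \<and> Q s' \<and> bnd B s')"
    "\<forall>s. Q s \<and> bnd B s \<longrightarrow> (\<exists>t s'. exec c2 s t s' \<and> t \<le> budget c2 \<and> S s' \<and> bnd B s')"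
    "P s \<and> bnd B s"
  then obtain t1 s1 where 1: "exec c1 s t1 s1" "t1 \<le> budget c1" "Q s1" "bnd B s1" by blast
  with a(2) obtain t2 s2 where 2: "exec c2 s1 t2 s2" "t2 \<le> budget c2" "S s2" "bnd B s2" by blast
  have "t1 + t2 \<le> budget (Seq c1 c2)" using 1(2) 2(2) budget_Seq[of c1 c2] by linarith
  with 1 2 show "\<exists>t s'. exec (Seq c1 c2) s t s' \<and> t \<le> budget (Seq c1 c2) \<and> S s' \<and> bnd B s'"
    by (blast intro: exec.Seq)
qed

lemma budget_If: "1 + weight b ^ 2 * (B + 1) + max (budget c1) (budget c2) \<le> budget (If b c1 c2)"
proof -
  let ?d = "(R + 1) ^ depth (If b c1 c2)"
  have "budget c1 \<le> work c1 * ?d * (B + 1)" "budget c2 \<le> work c2 * ?d * (B + 1)"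
    unfolding budget_def by (intro budget_mono; simp)+
  then have 1: "max (budget c1) (budget c2) \<le> work c1 * ?d * (B + 1) + work c2 * ?d * (B + 1)" by simp
  have "1 + weight b ^ 2 * (B + 1) \<le> (1 + weight b ^ 2) * 1 * (B + 1)" by (simp add: algebra_simps)
  also have "\<dots> \<le> (1 + weight b ^ 2) * ?d * (B + 1)"
    by (intro mult_right_mono mult_left_mono) auto
  finally have 2: "1 + weight b ^ 2 * (B + 1) \<le> (1 + weight b ^ 2) * ?d * (B + 1)" .
  have "budget (If b c1 c2) = (1 + weight b ^ 2) * ?d * (B + 1) + (work c1 * ?d * (B + 1) + work c2 * ?d * (B + 1))"
    unfolding budget_def work.simps distrib_right by simp
  with 1 2 show ?thesis by linarith
qed

lemma ht_If:
  assumes "ht P1 c1 Q" "ht P2 c2 Q"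
  shows "ht (\<lambda>s. if val b s \<noteq> 0 then P1 s else P2 s) (If b c1 c2) Q"
  unfolding ht_def
proof (intro allI impI)
  fix s assume s: "(if val b s \<noteq> 0 then P1 s else P2 s) \<and> bnd B s"
  have c: "cost b s \<le> weight b ^ 2 * (B + 1)" using s cost_bound by blast
  show "\<exists>t s'. exec (If b c1 c2) s t s' \<and> t \<le> budget (If b c1 c2) \<and> Q s' \<and> bnd B s'"
  proof (cases "val b s = 0")
    case True
    with s have "P2 s" "bnd B s" by simp_all
    from htD[OF assms(2) this] obtain t s' where "exec c2 s t s'" "t \<le> budget c2" "Q s'" "bnd B s'"
      by blast
    moreover from this True have "exec (If b c1 c2) s (1 + cost b s + t) s'" by (intro exec.IfFalse)
    moreover have "1 + cost b s + t \<le> budget (If b c1 c2)"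
      using budget_If[of b c1 c2] c \<open>t \<le> budget c2\<close> by linarith
    ultimately show ?thesis by blast
  next
    case False
    with s have "P1 s" "bnd B s" by simp_all
    from htD[OF assms(1) this] obtain t s' where "exec c1 s t s'" "t \<le> budget c1" "Q s'" "bnd B s'"
      by blast
    moreover from this False have "exec (If b c1 c2) s (1 + cost b s + t) s'" by (intro exec.IfTrue)
    moreover have "1 + cost b s + t \<le> budget (If b c1 c2)"
      using budget_If[of b c1 c2] c \<open>t \<le> budget c1\<close> by linarith
    ultimately show ?thesis by blast
  qed
qed

text \<open>All loops of the program have an iteration count known in advance, so an invariant
  indexed by the counter also proves termination. At most \<open>R\<close> iterations and the final
  failing test account for the factor \<open>R + 1\<close>.\<close>

lemma ht_While:
  assumes body: "\<And>k. k < N \<Longrightarrow> ht (I k) c (I (Suc k))"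
    and cond: "\<And>k s. k \<le> N \<Longrightarrow> I k s \<Longrightarrow> val b s \<noteq> 0 \<longleftrightarrow> k < N"
    and N: "N \<le> R"
  shows "ht (I 0) (While b c) (I N)"
proof -
  let ?C = "1 + weight b ^ 2 * (B + 1)"
  have step: "\<exists>t s'. exec (While b c) s t s' \<and> t \<le> (N - k) * (?C + budget c) + ?C \<and> I N s' \<and> bnd B s'"
    if "k \<le> N" "I k s" "bnd B s" for k s
    using that
  proof (induction "N - k" arbitrary: k s)
    case 0
    then have k: "k = N" by simp
    with 0 cond have "val b s = 0" by blast
    moreover have "cost b s \<le> weight b ^ 2 * (B + 1)" using 0 cost_bound by blast
    ultimately show ?case using 0 k exec.WhileFalse[of b s c]
      by (intro exI[of _ "1 + cost b s"] exI[of _ s]) simp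
  next
    case (Suc d)
    then have k: "k < N" by simp
    with Suc.prems obtain t1 s1 where 1: "exec c s t1 s1" "t1 \<le> budget c" "I (Suc k) s1" "bnd B s1"
      using htD[OF body[OF k]] by blast
    have "d = N - Suc k" using Suc.hyps(2) by simp
    from Suc.hyps(1)[OF this _ 1(3,4)] k obtain t2 s2 where 2: "exec (While b c) s1 t2 s2"
      "t2 \<le> (N - Suc k) * (?C + budget c) + ?C" "I N s2" "bnd B s2" by auto
    have "val b s \<noteq> 0" using cond[of k s] k Suc.prems by simp
    then have "exec (While b c) s (1 + cost b s + t1 + t2) s2" using 1 2 by (intro exec.WhileTrue)
    moreover have "1 + cost b s + t1 + t2 \<le> (N - k) * (?C + budget c) + ?C"
    proof -
      have "N - k = Suc (N - Suc k)" using k by simp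
      then have "(N - k) * (?C + budget c) = (?C + budget c) + (N - Suc k) * (?C + budget c)" by simp
      moreover have "cost b s \<le> weight b ^ 2 * (B + 1)" using Suc.prems cost_bound by blast
      ultimately show ?thesis using 1(2) 2(2) by linarith
    qed
    ultimately show ?case using 2 by blast
  qed
  have "N * (?C + budget c) + ?C \<le> R * (?C + budget c) + ?C"
    using N by (intro add_right_mono mult_right_mono) auto
  also have "\<dots> \<le> (R + 1) * (?C + budget c)" by simp
  also have "\<dots> \<le> (R + 1) * ((1 + weight b ^ 2) * (R + 1) ^ depth c * (B + 1) + budget c)"
  proof -
    have "?C \<le> (1 + weight b ^ 2) * 1 * (B + 1)" by (simp add: algebra_simps)
    also have "\<dots> \<le> (1 + weight b ^ 2) * (R + 1) ^ depth c * (B + 1)"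
      by (intro mult_right_mono mult_left_mono) auto
    finally show ?thesis by (intro mult_left_mono add_right_mono) auto
  qed
  also have "\<dots> = budget (While b c)" by (simp add: budget_def algebra_simps)
  finally have *: "N * (?C + budget c) + ?C \<le> budget (While b c)" .
  show ?thesis
    unfolding ht_def
  proof (intro allI impI)
    fix s assume s: "I 0 s \<and> bnd B s"
    then obtain t s' where "exec (While b c) s t s'" "t \<le> (N - 0) * (?C + budget c) + ?C" "I N s'" "bnd B s'"
      using step[of 0 s] by blast
    moreover from this(2) have "t \<le> budget (While b c)"
      unfolding diff_zero using * by (rule le_trans)
    ultimately show "\<exists>t s'. exec (While b c) s t s' \<and> t \<le> budget (While b c) \<and> I N s' \<and> bnd B s'"
      by blast
  qed
qed

text \<open>Meant for loop-free code, which \<open>simp\<close> can then execute symbolically;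
  \<open>False\<close> for loops is sound, and loops are treated by \<open>ht_While\<close>.\<close>

fun wp :: "com \<Rightarrow> (state \<Rightarrow> bool) \<Rightarrow> state \<Rightarrow> bool" where
  "wp Skip Q s = Q s"
| "wp (Assign a i e) Q s = (val e s \<le> B \<and> Q (s(a := (s a)(val i s := val e s))))"
| "wp (Seq c1 c2) Q s = wp c1 (wp c2 Q) s"
| "wp (If b c1 c2) Q s = (if val b s \<noteq> 0 then wp c1 Q s else wp c2 Q s)"
| "wp (While b c) Q s = False"

lemma ht_wp: "ht (wp c Q) c Q"
proof (induction c arbitrary: Q)
  case Skip
  have "wp Skip Q = Q" by (rule ext) simp
  then show ?case by (simp add: ht_Skip)
next
  case (Assign a i e)
  have "wp (Assign a i e) Q = (\<lambda>s. val e s \<le> B \<and> Q (s(a := (s a)(val i s := val e s))))" by (rule ext) simp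
  then show ?case using ht_Assign[of e Q a i] by simp
next
  case (Seq c1 c2)
  have "wp (Seq c1 c2) Q = wp c1 (wp c2 Q)" by (rule ext) simp
  then show ?case using ht_Seq[OF Seq.IH(1)[of "wp c2 Q"] Seq.IH(2)[of Q]] by simp
next
  case (If b c1 c2)
  have "wp (If b c1 c2) Q = (\<lambda>s. if val b s \<noteq> 0 then wp c1 Q s else wp c2 Q s)" by (rule ext) simp
  then show ?case using ht_If[OF If.IH(1)[of Q] If.IH(2)[of Q]] by simp
next
  case (While b c)
  then show ?case by (simp add: ht_def)
qed

lemma ht_wpI: "(\<And>s. P s \<Longrightarrow> bnd B s \<Longrightarrow> wp c Q s) \<Longrightarrow> ht P c Q"
  using ht_conseq[OF ht_wp] by blast

end

section \<open>The program\<close>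

abbreviation Var :: "aname \<Rightarrow> exp" where
  "Var x \<equiv> Cell x (Const 0)"

abbreviation set_var :: "aname \<Rightarrow> exp \<Rightarrow> com" (infix "::=" 70) where
  "x ::= e \<equiv> Assign x (Const 0) e"

abbreviation seq (infixr ";;" 60) where
  "c1 ;; c2 \<equiv> Seq c1 c2"

text \<open>
  Finds the last index below \<open>l\<close> at which the array contains \<open>k\<close>. There being no multiplication,
  the first address \<open>30 * q\<close> of the vertices of arc \<open>q\<close> is maintained along with \<open>q\<close>, and
  \<open>p\<close> becomes its successor, or 0 if the search fails.
\<close>

definition search :: "aname \<Rightarrow> com" where
  "search A =
     ''p'' ::= Const 0 ;; ''q'' ::= Const 0 ;; ''c'' ::= Const 0 ;;
     While (Minus (Var ''l'') (Var ''q''))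
       (If (Plus (Minus (Cell A (Var ''q'')) (Var ''k'')) (Minus (Var ''k'') (Cell A (Var ''q''))))
          Skip (''p'' ::= Plus (Var ''c'') (Const 1)) ;;
        ''q'' ::= Plus (Var ''q'') (Const 1) ;; ''c'' ::= Plus (Var ''c'') (Const 30))"

primrec found :: "(nat \<Rightarrow> nat) \<Rightarrow> nat \<Rightarrow> nat \<Rightarrow> nat" where
  "found g k 0 = 0"
| "found g k (Suc L) = (if g L = k then Suc (30 * L) else found g k L)"

text \<open>Relates the search to \<open>last\<close> of \<open>before\<close> and of
  \<open>cols\<close>: one loop finds both the right-hand neighbour of a column and the left end of
  a line.\<close>

lemma found_filter:
  "found g k L = (let f = filter (\<lambda>e. g e = k) [0..<L] in if f = [] then 0 else Suc (30 * last f))"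
  by (induction L) (auto simp: Let_def)

text \<open>A gadget has a fixed number of arcs, so they are unrolled in the program text. The table
  \<open>''row''\<close> replaces the multiplication in a matrix address.\<close>

fun writes :: "((aname \<times> nat) \<times> (aname \<times> nat)) list \<Rightarrow> com" where
  "writes [] = Skip"
| "writes (((a, i), (b, j)) # xs) =
     Assign ''out'' (Plus (Cell ''row'' (Plus (Var a) (Const i))) (Plus (Var b) (Const j))) (Const 1) ;; writes xs"

definition addr :: "state \<Rightarrow> aname \<times> nat \<Rightarrow> nat" where
  "addr s x = s (fst x) 0 + snd x"

text \<open>A pair with \<open>y\<close> at least \<open>N\<close> would land in another row, hence
  the range condition of \<open>matrix_entry\<close>.\<close>

definition matrix :: "nat \<Rightarrow> (nat \<times> nat) set \<Rightarrow> nat \<Rightarrow> nat" where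
  "matrix N S p = (if \<exists>(x, y)\<in>S. p = Suc (x * N + y) then 1 else 0)"

text \<open>Row \<open>x\<close> of the output matrix starts at \<open>Suc (x * N)\<close>, since cell 0 holds the number of vertices.\<close>

definition rows :: "nat \<Rightarrow> state \<Rightarrow> bool" where
  "rows N s \<longleftrightarrow> (\<forall>x\<le>N. s ''row'' x = Suc (x * N))"

lemma matrix_insert: "(matrix N S)(Suc (x * N + y) := Suc 0) = matrix N (insert (x, y) S)"
  by (rule ext) (auto simp: matrix_def)

fun role_code :: "role \<Rightarrow> nat" where
  "role_code Pt = 0" | "role_code UL = 1" | "role_code UR = 2" | "role_code LL = 3" | "role_code LR = 4"
| "role_code Ca = 5" | "role_code Cb = 6" | "role_code Da = 7" | "role_code Db = 8" | "role_code Dc = 9"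
| "role_code Dd = 10" | "role_code Ea = 11" | "role_code Eb = 12" | "role_code Ec = 13" | "role_code Ed = 14"

definition offset :: "bool \<Rightarrow> role \<Rightarrow> nat" where
  "offset s r = role_code r + (if s then 15 else 0)"

definition code :: "vertex \<Rightarrow> nat" where
  "code = (\<lambda>(e, s, r). 30 * e + offset s r)"

lemma offset_less: "offset s r < 30"
  by (cases r; simp add: offset_def)

lemma role_code_less: "role_code r < 15"
  by (cases r) simp_all

lemma role_code_inj: "role_code r = role_code r' \<longleftrightarrow> r = r'"
  by (cases r; cases r') simp_all

lemma role_code_surj: "i < 15 \<Longrightarrow> \<exists>r. i = role_code r"
proof -
  assume "i < 15"
  then have "i = 0 \<or> i = 1 \<or> i = 2 \<or> i = 3 \<or> i = 4 \<or> i = 5 \<or> i = 6 \<or> i = 7 \<or> i = 8 \<or>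
    i = 9 \<or> i = 10 \<or> i = 11 \<or> i = 12 \<or> i = 13 \<or> i = 14" by presburger
  then show ?thesis
    by (elim disjE; metis role_code.simps)
qed

lemma code_inj: "inj code"
proof (rule injI)
  fix x y :: vertex assume eq: "code x = code y"
  obtain e s r e' s' r' where xy: "x = (e, s, r)" "y = (e', s', r')" by (metis surj_pair)
  from eq have "30 * e + offset s r = 30 * e' + offset s' r'" by (simp add: xy code_def)
  moreover from this have "e = e'"
    using offset_less[of s r] offset_less[of s' r'] by linarith
  ultimately have "e = e'" "offset s r = offset s' r'" by simp_all
  moreover from this(2) have "s = s'" "role_code r = role_code r'"
    using role_code_less[of r] role_code_less[of r'] by (auto simp: offset_def split: if_splits)
  ultimately show "x = y" by (simp add: xy role_code_inj)
qed

lemma code_image: "code ` gverts as = {..<30 * length as}"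
proof (intro equalityI subsetI)
  fix i assume "i \<in> code ` gverts as"
  then obtain e s r where "i = 30 * e + offset s r" "e < length as" by (auto simp: code_def gverts_def)
  then show "i \<in> {..<30 * length as}" using offset_less[of s r] by auto
next
  fix i assume "i \<in> {..<30 * length as}"
  then have e: "i div 30 < length as" by (simp add: less_mult_imp_div_less mult.commute)
  have "i mod 30 < 30" by simp
  then have "i mod 30 - (if 15 \<le> i mod 30 then 15 else 0) < 15" by (simp split: if_split, linarith)
  then obtain r where r: "i mod 30 - (if 15 \<le> i mod 30 then 15 else 0) = role_code r"
    using role_code_surj by blast
  then have "i mod 30 = offset (15 \<le> i mod 30) r" by (auto simp: offset_def split: if_splits)
  then have "i = code (i div 30, 15 \<le> i mod 30, r)" by (simp add: code_def)
  then show "i \<in> code ` gverts as" using e by (auto simp: gverts_def)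
qed

section \<open>Arc lists shared by the program text and the graph, and the program\<close>

definition both :: "'a \<Rightarrow> 'a \<Rightarrow> ('a \<times> 'a) list" where
  "both x y = [(x, y), (y, x)]"

definition roles :: "role list" where
  "roles = [Pt, UL, UR, LL, LR, Ca, Cb, Da, Db, Dc, Dd, Ea, Eb, Ec, Ed]"

lemma set_roles: "set roles = UNIV"
  unfolding UNIV_role roles_def by auto

text \<open>Generic in how vertices are named: with \<open>slot a\<close> the list becomes program
  text, with \<open>Pair e\<close> a set of arcs of the gadget graph. The three lists that follow
  have the same form.\<close>

definition inner_arcs :: "(bool \<times> role \<Rightarrow> 'a) \<Rightarrow> ('a \<times> 'a) list" where
  "inner_arcs f = [(f (s, r), f (s, r')). s \<leftarrow> [False, True], r \<leftarrow> roles, r' \<leftarrow> inner r] @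
     both (f (False, Pt)) (f (True, Pt))"

definition link_arcs :: "(bool \<times> role \<Rightarrow> 'a) \<Rightarrow> (bool \<times> role \<Rightarrow> 'a) \<Rightarrow> bool \<Rightarrow> ('a \<times> 'a) list" where
  "link_arcs f g s = both (f (s, UR)) (g (s, UL)) @ both (f (s, LR)) (g (s, LL))"

definition turn_arcs :: "(bool \<times> role \<Rightarrow> 'a) \<Rightarrow> bool \<Rightarrow> ('a \<times> 'a) list" where
  "turn_arcs f s = both (f (s, UR)) (f (s, LR))"

definition middle_arcs :: "(bool \<times> role \<Rightarrow> 'a) \<Rightarrow> (bool \<times> role \<Rightarrow> 'a) \<Rightarrow> ('a \<times> 'a) list" where
  "middle_arcs f g = both (f (False, UL)) (g (True, UL)) @ both (f (False, LL)) (g (True, LL))"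

definition slot :: "aname \<Rightarrow> bool \<times> role \<Rightarrow> aname \<times> nat" where
  "slot a x = (a, offset (fst x) (snd x))"

text \<open>A link is attributed to its left column, which has the larger index, because a search
  below that index finds the right-hand neighbour.\<close>

definition column_arcs :: "(nat \<times> nat) list \<Rightarrow> bool \<Rightarrow> nat \<Rightarrow> (vertex \<times> vertex) set" where
  "column_arcs as s e = set (if before as s e = [] then turn_arcs (Pair e) s
     else link_arcs (Pair e) (Pair (last (before as s e))) s)"

definition arc_arcs :: "(nat \<times> nat) list \<Rightarrow> nat \<Rightarrow> (vertex \<times> vertex) set" where
  "arc_arcs as e = set (inner_arcs (Pair e)) \<union> column_arcs as False e \<union> column_arcs as True e"

definition vertex_arcs :: "(nat \<times> nat) list \<Rightarrow> nat \<Rightarrow> (vertex \<times> vertex) set" where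
  "vertex_arcs as v = set (middle_arcs (Pair (last (cols as False v))) (Pair (last (cols as True v))))"

lemmas arcs_list_defs = inner_arcs_def link_arcs_def turn_arcs_def middle_arcs_def both_def

text \<open>Naturality in the naming. Combined with \<open>addr_slot\<close>, it identifies the
  addresses computed at run time with the codes of the intended arcs.\<close>

lemma map_arcs:
  "map (map_prod h h) (inner_arcs f) = inner_arcs (h \<circ> f)"
  "map (map_prod h h) (link_arcs f g s) = link_arcs (h \<circ> f) (h \<circ> g) s"
  "map (map_prod h h) (turn_arcs f s) = turn_arcs (h \<circ> f) s"
  "map (map_prod h h) (middle_arcs f g) = middle_arcs (h \<circ> f) (h \<circ> g)"
  by (simp_all add: arcs_list_defs map_concat comp_def)

lemma arcs_in_range:
  "x \<in> set (inner_arcs f) \<Longrightarrow> fst x \<in> range f \<and> snd x \<in> range f"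
  "x \<in> set (link_arcs f g s) \<Longrightarrow> fst x \<in> range f \<union> range g \<and> snd x \<in> range f \<union> range g"
  "x \<in> set (turn_arcs f s) \<Longrightarrow> fst x \<in> range f \<and> snd x \<in> range f"
  "x \<in> set (middle_arcs f g) \<Longrightarrow> fst x \<in> range f \<union> range g \<and> snd x \<in> range f \<union> range g"
  by (auto simp: arcs_list_defs)

definition array :: "bool \<Rightarrow> aname" where
  "array s = (if s then ''hd'' else ''tl'')"

definition link :: "bool \<Rightarrow> com" where
  "link s = If (Var ''p'')
     (''p'' ::= Minus (Var ''p'') (Const 1) ;; writes (link_arcs (slot ''b'') (slot ''p'') s))
     (writes (turn_arcs (slot ''b'') s))"

definition column :: "bool \<Rightarrow> com" where
  "column s = ''k'' ::= Cell (array s) (Var ''e'') ;; search (array s) ;; link s"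

definition arcs_loop :: com where
  "arcs_loop = ''e'' ::= Const 0 ;; ''b'' ::= Const 0 ;;
     While (Minus (Var ''m'') (Var ''e''))
       ((''l'' ::= Var ''e'' ;; writes (inner_arcs (slot ''b''))) ;; column False ;; column True ;;
        ''e'' ::= Plus (Var ''e'') (Const 1) ;; ''b'' ::= Plus (Var ''b'') (Const 30))"

definition vertices_loop :: com where
  "vertices_loop = ''v'' ::= Const 0 ;; ''l'' ::= Var ''m'' ;;
     While (Minus (Var ''n'') (Var ''v''))
       (''k'' ::= Var ''v'' ;; search ''tl'' ;; ''w'' ::= Minus (Var ''p'') (Const 1) ;; search ''hd'' ;;
        ''p'' ::= Minus (Var ''p'') (Const 1) ;; writes (middle_arcs (slot ''w'') (slot ''p'')) ;;
        ''v'' ::= Plus (Var ''v'') (Const 1))"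

definition rows_loop :: com where
  "rows_loop = ''x'' ::= Const 0 ;; Assign ''row'' (Const 0) (Const 1) ;;
     While (Minus (Var ''N'') (Var ''x''))
       (Assign ''row'' (Plus (Var ''x'') (Const 1)) (Plus (Cell ''row'' (Var ''x'')) (Var ''N'')) ;;
        ''x'' ::= Plus (Var ''x'') (Const 1))"

text \<open>The counters \<open>''i''\<close> and \<open>''j''\<close> replace the division of the
  position by \<open>n\<close>. Together with \<open>''m''\<close> and \<open>''N''\<close> they
  rely on memory being initially 0.\<close>

definition scan :: com where
  "scan = ''n'' ::= Cell ''in'' (Const 0) ;; ''pos'' ::= Const 1 ;;
     While (Minus (Var ''inlen'') (Var ''pos''))
       (If (Cell ''in'' (Var ''pos''))
          (Assign ''tl'' (Var ''m'') (Var ''i'') ;; Assign ''hd'' (Var ''m'') (Var ''j'') ;;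
           ''m'' ::= Plus (Var ''m'') (Const 1) ;; ''N'' ::= Plus (Var ''N'') (Const 30)) Skip ;;
        ''pos'' ::= Plus (Var ''pos'') (Const 1) ;; ''j'' ::= Plus (Var ''j'') (Const 1) ;;
        If (Minus (Var ''n'') (Var ''j'')) Skip (''j'' ::= Const 0 ;; ''i'' ::= Plus (Var ''i'') (Const 1)))"

definition check :: com where
  "check = ''v'' ::= Const 0 ;; ''bad'' ::= Const 0 ;; ''l'' ::= Var ''m'' ;;
     While (Minus (Var ''n'') (Var ''v''))
       (''k'' ::= Var ''v'' ;; search ''tl'' ;; If (Var ''p'') Skip (''bad'' ::= Const 1) ;;
        search ''hd'' ;; If (Var ''p'') Skip (''bad'' ::= Const 1) ;; ''v'' ::= Plus (Var ''v'') (Const 1))"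

definition repair :: com where
  "repair = If (Var ''bad'')
     (''n'' ::= Const 4 ;; ''m'' ::= Const 4 ;; ''N'' ::= Const 120 ;;
      Assign ''tl'' (Const 0) (Const 0) ;; Assign ''hd'' (Const 0) (Const 1) ;;
      Assign ''tl'' (Const 1) (Const 1) ;; Assign ''hd'' (Const 1) (Const 0) ;;
      Assign ''tl'' (Const 2) (Const 2) ;; Assign ''hd'' (Const 2) (Const 3) ;;
      Assign ''tl'' (Const 3) (Const 3) ;; Assign ''hd'' (Const 3) (Const 2)) Skip"

text \<open>The table entry at \<open>N\<close> lies one row past the end: it is
  \<open>1 + N * N\<close>, the length of the output.\<close>

definition finish :: com where
  "finish = Assign ''out'' (Const 0) (Var ''N'') ;; ''outlen'' ::= Cell ''row'' (Var ''N'')"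

definition prog :: com where
  "prog = scan ;; check ;; repair ;; rows_loop ;; arcs_loop ;; vertices_loop ;; finish"

section \<open>Verification of the search and of the drawing\<close>

definition frame :: "aname set \<Rightarrow> (state \<Rightarrow> bool) \<Rightarrow> bool" where
  "frame X P \<longleftrightarrow> (\<forall>s s'. (\<forall>a. a \<notin> X \<longrightarrow> s' a = s a) \<longrightarrow> P s \<longrightarrow> P s')"

lemma frame_upd: "frame X P \<Longrightarrow> a \<in> X \<Longrightarrow> P (s(a := f)) \<longleftrightarrow> P s"
  unfolding frame_def by (metis fun_upd_other)

lemma frameI: "(\<And>s s'. P s \<Longrightarrow> (\<And>a. a \<notin> X \<Longrightarrow> s' a = s a) \<Longrightarrow> P s') \<Longrightarrow> frame X P"
  unfolding frame_def by blast

context machine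
begin

lemma ht_prefix: "ht Q c2 S \<Longrightarrow> ht (wp c1 Q) (c1 ;; c2) S"
  by (rule ht_Seq[OF ht_wp])

text \<open>The context \<open>P\<close> is arbitrary apart from the three scratch arrays, so that
  the search is verified once and used inside different invariants.\<close>

lemma ht_search:
  assumes P: "frame {''p'', ''q'', ''c''} P"
    and ctx: "\<And>s. P s \<Longrightarrow> s ''k'' 0 = k \<and> s ''l'' 0 = L \<and> (\<forall>e<L. s A e = g e)"
    and A: "A \<noteq> ''p''" "A \<noteq> ''q''" "A \<noteq> ''c''" and LR: "L \<le> R" "30 * L + 30 \<le> B"
  shows "ht P (search A) (\<lambda>s. P s \<and> s ''p'' 0 = found g k L)"
proof -
  define I where "I j s \<longleftrightarrow> P s \<and> s ''p'' 0 = found g k j \<and> s ''q'' 0 = j \<and> s ''c'' 0 = 30 * j" for j s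
  have upd: "P (s(x := f)) \<longleftrightarrow> P s" if "x = ''p'' \<or> x = ''q'' \<or> x = ''c''" for x f s
    using frame_upd[OF P, of x s f] that by blast
  let ?b = "If (Plus (Minus (Cell A (Var ''q'')) (Var ''k'')) (Minus (Var ''k'') (Cell A (Var ''q''))))
          Skip (''p'' ::= Plus (Var ''c'') (Const 1)) ;;
        ''q'' ::= Plus (Var ''q'') (Const 1) ;; ''c'' ::= Plus (Var ''c'') (Const 30)"
  let ?w = "While (Minus (Var ''l'') (Var ''q'')) ?b"
  have "ht (I 0) ?w (I L)"
  proof (rule ht_While)
    fix j assume j: "j < L"
    show "ht (I j) ?b (I (Suc j))"
    proof (rule ht_wpI)
      fix s assume s: "I j s"
      with ctx have c: "s ''k'' 0 = k" "s A j = g j" using j by (auto simp: I_def)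
      show "wp ?b (I (Suc j)) s"
        using s c j LR A by (simp add: I_def upd)
    qed
  qed (use ctx LR in \<open>auto simp: I_def\<close>)
  then have "ht (wp (''p'' ::= Const 0) (wp (''q'' ::= Const 0) (wp (''c'' ::= Const 0) (I 0)))) (search A) (I L)"
    unfolding search_def by (intro ht_prefix)
  then show ?thesis
    by (rule ht_conseq) (simp_all add: I_def upd)
qed

text \<open>All addresses may be evaluated in the initial state, since only \<open>''out''\<close>
  changes and no address depends on it. Describing the matrix by a set makes repeated writes
  harmless.\<close>

lemma wp_writes:
  assumes "rows N s" "s ''out'' = matrix N S" "1 \<le> B"
    and "\<And>x y. (x, y) \<in> set xs \<Longrightarrow> fst x \<noteq> ''out'' \<and> fst y \<noteq> ''out'' \<and> addr s x < N"
    and "Q (s(''out'' := matrix N (S \<union> map_prod (addr s) (addr s) ` set xs)))"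
  shows "wp (writes xs) Q s"
  using assms
proof (induction xs arbitrary: s S)
  case Nil
  have "s(''out'' := s ''out'') = s" by simp
  with Nil show ?case by (simp add: Nil(2)[symmetric])
next
  case (Cons z xs)
  obtain a i b j where z: "z = ((a, i), (b, j))" by (metis surj_pair)
  let ?s = "s(''out'' := matrix N (insert (addr s (a, i), addr s (b, j)) S))"
  have ab: "a \<noteq> ''out''" "b \<noteq> ''out''" "addr s (a, i) < N" using Cons.prems(4)[of "(a, i)" "(b, j)"] by (auto simp: z)
  have addr: "addr ?s x = addr s x" if "fst x \<noteq> ''out''" for x using that by (simp add: addr_def)
  have ad: "map_prod (addr ?s) (addr ?s) ` set xs = map_prod (addr s) (addr s) ` set xs"
  proof (intro image_cong refl)
    fix q assume "q \<in> set xs"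
    moreover obtain x y where "q = (x, y)" by (cases q)
    ultimately show "map_prod (addr ?s) (addr ?s) q = map_prod (addr s) (addr s) q"
      using Cons.prems(4)[of x y] addr[of x] addr[of y] by simp
  qed
  have "wp (writes xs) Q ?s"
  proof (rule Cons.IH)
    show "rows N ?s" using Cons.prems(1) by (simp add: rows_def)
    show "?s ''out'' = matrix N (insert (addr s (a, i), addr s (b, j)) S)" by simp
    show "1 \<le> B" by fact
    show "fst x \<noteq> ''out'' \<and> fst y \<noteq> ''out'' \<and> addr ?s x < N" if "(x, y) \<in> set xs" for x y
      using Cons.prems(4)[of x y] that addr[of x] by (simp add: z)
    show "Q (?s(''out'' := matrix N (insert (addr s (a, i), addr s (b, j)) S \<union> map_prod (addr ?s) (addr ?s) ` set xs)))"
      using Cons.prems(5) unfolding ad fun_upd_upd z list.set image_insert map_prod_simp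
      by (simp only: Un_insert_left Un_insert_right)
  qed
  moreover have "val (Plus (Cell ''row'' (Plus (Var a) (Const i))) (Plus (Var b) (Const j))) s =
      Suc (addr s (a, i) * N + addr s (b, j))"
    using Cons.prems(1) ab by (simp add: rows_def addr_def)
  moreover have "(s ''out'')(Suc (addr s (a, i) * N + addr s (b, j)) := Suc 0) =
      matrix N (insert (addr s (a, i), addr s (b, j)) S)"
    unfolding Cons.prems(2) by (rule matrix_insert)
  ultimately show ?case using Cons.prems(3) by (simp add: z)
qed

end

context reduction
begin

text \<open>Sorts the arcs by the part of the program that draws them. Inner and port arcs belong to
  the arc \<open>e\<close>; those at \<open>UR\<close> and \<open>LR\<close> to their own column;
  those at \<open>UL\<close> and \<open>LL\<close> to the next column on the left or, at a left end,
  to the vertex.\<close>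

lemma arcs_decomposition: "E = (\<Union>e<m. arc_arcs as e) \<union> (\<Union>v<n. vertex_arcs as v)"
proof (intro equalityI subsetI)
  fix p assume p: "p \<in> E"
  obtain e s r e' s' r' where pe: "p = ((e, s, r), (e', s', r'))" by (metis surj_pair)
  with p have e: "e < m" and alt: "e' = e \<and> s' = s \<and> r' \<in> set (inner r) \<or> r \<in> terminals \<and> ext as (e, s, r) = (e', s', r')"
    by (simp_all add: garcs_iff del: ext.simps)
  consider "e' = e" "s' = s" "r' \<in> set (inner r)"
    | "r = Pt" "ext as (e, s, r) = (e', s', r')"
    | "r = UR \<or> r = LR" "ext as (e, s, r) = (e', s', r')"
    | "r = UL \<or> r = LL" "ext as (e, s, r) = (e', s', r')"
    using alt by (auto simp: terminals_def simp del: ext.simps)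
  then show "p \<in> (\<Union>e<m. arc_arcs as e) \<union> (\<Union>v<n. vertex_arcs as v)"
  proof cases
    case 1
    then have "((e, s, r), (e, s, r')) \<in> set (inner_arcs (Pair e))"
      unfolding inner_arcs_def by (cases s) (simp_all add: set_roles image_iff)
    then have "p \<in> set (inner_arcs (Pair e))" using 1 by (simp add: pe)
    then show ?thesis using e by (auto simp: arc_arcs_def)
  next
    case 2
    then have "p \<in> set (inner_arcs (Pair e))"
      by (cases s) (auto simp: pe inner_arcs_def both_def)
    then show ?thesis using e by (auto simp: arc_arcs_def)
  next
    case 3
    have "(x, ext as x) \<in> column_arcs as s e" if "x = (e, s, UR) \<or> x = (e, s, LR)" for x
      using that by (elim disjE; cases "before as s e = []")
        (simp_all add: column_arcs_def turn_arcs_def link_arcs_def both_def)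
    then have "p \<in> column_arcs as s e"
      unfolding pe using 3 by metis
    then show ?thesis using e by (cases s) (auto simp: arc_arcs_def)
  next
    case 4
    show ?thesis
    proof (cases "after as s e")
      case Nil
      have "(x, ext as x) \<in> vertex_arcs as (key as s e)" if "x = (e, s, UL) \<or> x = (e, s, LL)" for x
        using that Nil last_cols_eq[OF e Nil]
        by (elim disjE; cases s) (simp_all add: vertex_arcs_def middle_arcs_def both_def)
      then have "p \<in> vertex_arcs as (key as s e)"
        unfolding pe using 4 by metis
      then show ?thesis using key_lt[OF e, of s] by blast
    next
      case (Cons c xs)
      note c = after_Cons[OF Cons e]
      have "(x, ext as x) \<in> column_arcs as s c" if "x = (e, s, UL) \<or> x = (e, s, LL)" for x
        using that Cons c(5) by (elim disjE) (simp_all add: column_arcs_def link_arcs_def both_def)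
      then have "p \<in> column_arcs as s c"
        unfolding pe using 4 by metis
      then show ?thesis using c by (cases s) (auto simp: arc_arcs_def)
    qed
  qed
next
  have symE: "(y, x) \<in> E" if "(x, y) \<in> E" for x y using garcs_sym that by (rule symD)
  have both: "set (both x y) \<subseteq> E" if "(x, y) \<in> E" for x y
    using that symE by (auto simp: both_def)
  fix p assume "p \<in> (\<Union>e<m. arc_arcs as e) \<union> (\<Union>v<n. vertex_arcs as v)"
  then consider e where "e < m" "p \<in> set (inner_arcs (Pair e))" | e s where "e < m" "p \<in> column_arcs as s e"
    | v where "v < n" "p \<in> vertex_arcs as v"
    by (auto simp: arc_arcs_def)
  then show "p \<in> E"
  proof cases
    case (1 e)
    have "((e, False, Pt), (e, True, Pt)) \<in> E" using ext_step[OF 1(1), of Pt False] by (simp add: terminals_def)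
    from both[OF this] 1 inner_step show ?thesis by (auto simp: inner_arcs_def)
  next
    case (2 e s)
    have "((e, s, UR), ext as (e, s, UR)) \<in> E" "((e, s, LR), ext as (e, s, LR)) \<in> E"
      using 2 ext_step[of e UR s] ext_step[of e LR s] by (simp_all add: terminals_def del: ext.simps)
    note * = both[OF this(1)] both[OF this(2)]
    with 2 show ?thesis
      by (cases "before as s e = []") (auto simp: column_arcs_def turn_arcs_def link_arcs_def)
  next
    case (3 v)
    let ?e = "last (cols as False v)"
    have e: "?e < m" "key as False ?e = v" "after as False ?e = []"
      using last_cols[OF 3(1)] after_last_cols[OF 3(1)] by auto
    have "((?e, False, UL), ext as (?e, False, UL)) \<in> E" "((?e, False, LL), ext as (?e, False, LL)) \<in> E"
      using e ext_step[of ?e UL False] ext_step[of ?e LL False] by (simp_all add: terminals_def del: ext.simps)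
    note * = both[OF this(1)] both[OF this(2)]
    with 3 e show ?thesis
      by (auto simp: vertex_arcs_def middle_arcs_def)
  qed
qed

end

definition ready :: "nat \<Rightarrow> (nat \<times> nat) list \<Rightarrow> state \<Rightarrow> bool" where
  "ready n as s \<longleftrightarrow> s ''n'' 0 = n \<and> s ''m'' 0 = length as \<and> s ''N'' 0 = 30 * length as \<and>
     (\<forall>e<length as. s ''tl'' e = fst (as ! e) \<and> s ''hd'' e = snd (as ! e))"

definition drawn :: "(nat \<times> nat) list \<Rightarrow> (vertex \<times> vertex) set \<Rightarrow> state \<Rightarrow> bool" where
  "drawn as S s \<longleftrightarrow> s ''out'' = matrix (30 * length as) (map_prod code code ` S)"

definition canvas :: "nat \<Rightarrow> (nat \<times> nat) list \<Rightarrow> (vertex \<times> vertex) set \<Rightarrow> state \<Rightarrow> bool" where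
  "canvas n as S s \<longleftrightarrow> ready n as s \<and> rows (30 * length as) s \<and> drawn as S s"

lemmas canvas_defs = canvas_def ready_def rows_def drawn_def

lemma addr_slot: "s a 0 = 30 * e \<Longrightarrow> addr s \<circ> slot a = code \<circ> Pair e"
  by (rule ext) (auto simp: addr_def slot_def code_def)

lemma found_before: "found (key as t) (key as t e) e =
    (if before as t e = [] then 0 else Suc (30 * last (before as t e)))"
  by (simp add: found_filter before_def Let_def)

lemma found_cols: "found (key as t) v (length as) =
    (if cols as t v = [] then 0 else Suc (30 * last (cols as t v)))"
  by (simp add: found_filter cols_def Let_def)

lemma ready_array: "ready n as s \<Longrightarrow> e < length as \<Longrightarrow> s (array t) e = key as t e"
  by (simp add: ready_def array_def key_def)

context machine
begin

lemma bndD: "bnd B s \<Longrightarrow> s a i \<le> B"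
  by (simp add: bnd_def)

text \<open>Restates \<open>wp_writes\<close> in terms of vertices. The premise equates lists, not
  sets, because this is the form in which \<open>map_arcs\<close> delivers it.\<close>

lemma wp_draw:
  assumes "canvas n as S s" "1 \<le> B"
    and "map (map_prod (addr s) (addr s)) xs = map (map_prod code code) ys"
    and "\<And>x y. (x, y) \<in> set xs \<Longrightarrow> fst x \<noteq> ''out'' \<and> fst y \<noteq> ''out''"
    and "\<And>x y. (x, y) \<in> set ys \<Longrightarrow> x \<in> gverts as"
    and "Q (s(''out'' := matrix (30 * length as) (map_prod code code ` (S \<union> set ys))))"
  shows "wp (writes xs) Q s"
proof (rule wp_writes[of "30 * length as"])
  have set_eq: "map_prod (addr s) (addr s) ` set xs = map_prod code code ` set ys"
    using arg_cong[OF assms(3), of set] by simp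
  show "rows (30 * length as) s" "s ''out'' = matrix (30 * length as) (map_prod code code ` S)"
    using assms(1) by (auto simp: canvas_def drawn_def)
  show "Q (s(''out'' := matrix (30 * length as)
      (map_prod code code ` S \<union> map_prod (addr s) (addr s) ` set xs)))"
    using assms(6) unfolding set_eq image_Un .
  show "fst x \<noteq> ''out'' \<and> fst y \<noteq> ''out'' \<and> addr s x < 30 * length as" if xy: "(x, y) \<in> set xs" for x y
  proof -
    have "(addr s x, addr s y) \<in> map_prod code code ` set ys"
      unfolding set_eq[symmetric] using xy by force
    then obtain u w where "(u, w) \<in> set ys" "addr s x = code u" by auto
    with assms(5) have "addr s x \<in> code ` gverts as" by blast
    then show ?thesis using assms(4)[OF xy] by (simp add: code_image)
  qed
qed (use assms in auto)

definition at_arc :: "nat \<Rightarrow> (nat \<times> nat) list \<Rightarrow> nat \<Rightarrow> (vertex \<times> vertex) set \<Rightarrow> state \<Rightarrow> bool" where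
  "at_arc n as e S s \<longleftrightarrow> canvas n as S s \<and> s ''e'' 0 = e \<and> s ''b'' 0 = 30 * e \<and> s ''l'' 0 = e"

lemma range_Pair: "e < length as \<Longrightarrow> x \<in> range (Pair e) \<Longrightarrow> x \<in> gverts as"
  by (auto simp: gverts_def)

lemma before_less: "before as t e \<noteq> [] \<Longrightarrow> last (before as t e) < e"
  using last_in_set[of "before as t e"] by (auto simp: before_def)

lemma ht_link:
  assumes e: "e < length as" and B: "1 \<le> B" "30 * length as \<le> B"
  shows "ht (\<lambda>s. at_arc n as e S s \<and> s ''p'' 0 = found (key as t) (key as t e) e) (link t)
    (at_arc n as e (S \<union> column_arcs as t e))"
proof (rule ht_wpI)
  fix s assume s: "at_arc n as e S s \<and> s ''p'' 0 = found (key as t) (key as t e) e"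
  show "wp (link t) (at_arc n as e (S \<union> column_arcs as t e)) s"
  proof (cases "before as t e = []")
    case True
    have "wp (writes (turn_arcs (slot ''b'') t)) (at_arc n as e (S \<union> column_arcs as t e)) s"
    proof (rule wp_draw)
      show "canvas n as S s" using s by (simp add: at_arc_def)
      show "map (map_prod (addr s) (addr s)) (turn_arcs (slot ''b'') t) = map (map_prod code code) (turn_arcs (Pair e) t)"
        unfolding map_arcs using s by (simp add: at_arc_def addr_slot)
      show "fst x \<noteq> ''out'' \<and> fst y \<noteq> ''out''" if "(x, y) \<in> set (turn_arcs (slot ''b'') t)" for x y
        using arcs_in_range(3)[OF that] by (auto simp: slot_def)
      show "x \<in> gverts as" if "(x, y) \<in> set (turn_arcs (Pair e) t)" for x y
        using arcs_in_range(3)[OF that] range_Pair[OF e] by auto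
      show "at_arc n as e (S \<union> column_arcs as t e)
          (s(''out'' := matrix (30 * length as) (map_prod code code ` (S \<union> set (turn_arcs (Pair e) t)))))"
        using s True by (simp add: at_arc_def canvas_defs column_arcs_def)
    qed (rule B)
    then show ?thesis using s True by (simp add: link_def found_before)
  next
    case False
    define c where "c = last (before as t e)"
    have c: "c < e" using before_less[OF False] by (simp add: c_def)
    \<comment> \<open>A successful search returns the address plus 1, in order to be distinguishable
      from failure; here the 1 has been subtracted.\<close>
    let ?s = "s(''p'' := (s ''p'')(0 := 30 * c))"
    have "wp (writes (link_arcs (slot ''b'') (slot ''p'') t)) (at_arc n as e (S \<union> column_arcs as t e)) ?s"
    proof (rule wp_draw)
      show "canvas n as S ?s" using s by (simp add: at_arc_def canvas_defs)
      show "map (map_prod (addr ?s) (addr ?s)) (link_arcs (slot ''b'') (slot ''p'') t) =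
          map (map_prod code code) (link_arcs (Pair e) (Pair c) t)"
        unfolding map_arcs using s by (simp add: at_arc_def addr_slot)
      show "fst x \<noteq> ''out'' \<and> fst y \<noteq> ''out''" if "(x, y) \<in> set (link_arcs (slot ''b'') (slot ''p'') t)" for x y
        using arcs_in_range(2)[OF that] by (auto simp: slot_def)
      show "x \<in> gverts as" if "(x, y) \<in> set (link_arcs (Pair e) (Pair c) t)" for x y
        using arcs_in_range(2)[OF that] range_Pair[OF e] range_Pair[of c] c e by auto
      show "at_arc n as e (S \<union> column_arcs as t e)
          (?s(''out'' := matrix (30 * length as) (map_prod code code ` (S \<union> set (link_arcs (Pair e) (Pair c) t)))))"
        using s False by (simp add: at_arc_def canvas_defs column_arcs_def c_def)
    qed (rule B)
    then show ?thesis using s False c e B by (simp add: link_def found_before c_def)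
  qed
qed

lemma ht_column:
  assumes e: "e < length as" and B: "30 * length as + 30 \<le> B" and R: "length as \<le> R"
  shows "ht (at_arc n as e S) (column t) (at_arc n as e (S \<union> column_arcs as t e))"
proof -
  let ?P = "\<lambda>s. at_arc n as e S s \<and> s ''k'' 0 = key as t e"
  have "ht ?P (search (array t)) (\<lambda>s. ?P s \<and> s ''p'' 0 = found (key as t) (key as t e) e)"
  proof (rule ht_search)
    show "frame {''p'', ''q'', ''c''} ?P"
      by (rule frameI) (simp add: at_arc_def canvas_defs)
    show "s ''k'' 0 = key as t e \<and> s ''l'' 0 = e \<and> (\<forall>e'<e. s (array t) e' = key as t e')" if "?P s" for s
      using that e ready_array[of n as s] by (auto simp: at_arc_def canvas_def)
  qed (use assms in \<open>auto simp: array_def\<close>)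
  then have "ht ?P (search (array t)) (\<lambda>s. at_arc n as e S s \<and> s ''p'' 0 = found (key as t) (key as t e) e)"
    by (rule ht_conseq) simp_all
  from ht_Seq[OF this ht_link[OF e]] B
  have "ht ?P (search (array t) ;; link t) (at_arc n as e (S \<union> column_arcs as t e))" by simp
  moreover have "ht (at_arc n as e S) (''k'' ::= Cell (array t) (Var ''e'')) ?P"
    using e by (intro ht_wpI) (auto simp: at_arc_def canvas_defs bndD array_def key_def)
  ultimately show ?thesis unfolding column_def by (rule ht_Seq[rotated])
qed

lemma ht_arcs_loop:
  assumes B: "30 * length as + 30 \<le> B" and R: "length as \<le> R"
  shows "ht (canvas n as {}) arcs_loop (canvas n as (\<Union>e<length as. arc_arcs as e))"
proof -
  define I where "I e s \<longleftrightarrow> canvas n as (\<Union>e'<e. arc_arcs as e') s \<and> s ''e'' 0 = e \<and> s ''b'' 0 = 30 * e" for e s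
  let ?b = "(''l'' ::= Var ''e'' ;; writes (inner_arcs (slot ''b''))) ;; column False ;; column True ;;
        ''e'' ::= Plus (Var ''e'') (Const 1) ;; ''b'' ::= Plus (Var ''b'') (Const 30)"
  let ?w = "While (Minus (Var ''m'') (Var ''e'')) ?b"
  have "ht (I 0) ?w (I (length as))"
  proof (rule ht_While)
    fix e assume e: "e < length as"
    let ?S = "(\<Union>e'<e. arc_arcs as e')"
    let ?S1 = "?S \<union> set (inner_arcs (Pair e))"
    have "ht (I e) (''l'' ::= Var ''e'' ;; writes (inner_arcs (slot ''b''))) (at_arc n as e ?S1)"
    proof (rule ht_wpI)
      fix s assume s: "I e s" "bnd B s"
      let ?s = "s(''l'' := (s ''l'')(0 := e))"
      have "wp (writes (inner_arcs (slot ''b''))) (at_arc n as e ?S1) ?s"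
      proof (rule wp_draw)
        show "canvas n as ?S ?s" using s by (simp add: I_def canvas_defs)
        show "map (map_prod (addr ?s) (addr ?s)) (inner_arcs (slot ''b'')) = map (map_prod code code) (inner_arcs (Pair e))"
          unfolding map_arcs using s by (simp add: I_def addr_slot)
        show "fst x \<noteq> ''out'' \<and> fst y \<noteq> ''out''" if "(x, y) \<in> set (inner_arcs (slot ''b''))" for x y
          using arcs_in_range(1)[OF that] by (auto simp: slot_def)
        show "x \<in> gverts as" if "(x, y) \<in> set (inner_arcs (Pair e))" for x y
          using arcs_in_range(1)[OF that] range_Pair[OF e] by auto
        show "at_arc n as e ?S1 (?s(''out'' := matrix (30 * length as) (map_prod code code ` ?S1)))"
          using s by (simp add: at_arc_def I_def canvas_defs)
      qed (use B in simp)
      then show "wp (''l'' ::= Var ''e'' ;; writes (inner_arcs (slot ''b''))) (at_arc n as e ?S1) s"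
        using s bndD[OF s(2), of "''e''" 0] by (simp add: I_def)
    qed
    moreover note ht_column[OF e B R, of n ?S1 False]
      ht_column[OF e B R, of n "?S1 \<union> column_arcs as False e" True]
    moreover have "ht (at_arc n as e (?S1 \<union> column_arcs as False e \<union> column_arcs as True e))
        (''e'' ::= Plus (Var ''e'') (Const 1) ;; ''b'' ::= Plus (Var ''b'') (Const 30)) (I (Suc e))"
    proof (rule ht_wpI)
      have U: "(\<Union>e'<Suc e. arc_arcs as e') = ?S1 \<union> column_arcs as False e \<union> column_arcs as True e"
        by (auto simp: arc_arcs_def less_Suc_eq)
      fix s assume "at_arc n as e (?S1 \<union> column_arcs as False e \<union> column_arcs as True e) s"
      then show "wp (''e'' ::= Plus (Var ''e'') (Const 1) ;; ''b'' ::= Plus (Var ''b'') (Const 30)) (I (Suc e)) s"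
        unfolding I_def U using e B by (simp add: at_arc_def canvas_defs)
    qed
    ultimately show "ht (I e) ?b (I (Suc e))" by (blast intro: ht_Seq)
  qed (use R in \<open>auto simp: I_def canvas_defs\<close>)
  then have "ht (wp (''e'' ::= Const 0) (wp (''b'' ::= Const 0) (I 0))) arcs_loop (I (length as))"
    unfolding arcs_loop_def by (intro ht_prefix)
  then show ?thesis
    by (rule ht_conseq) (simp_all add: I_def canvas_defs)
qed

lemma ht_vertices_loop:
  assumes B: "30 * length as + 30 \<le> B" "n \<le> B" and R: "length as \<le> R" "n \<le> R"
    and cols: "\<And>v t. v < n \<Longrightarrow> cols as t v \<noteq> []"
  shows "ht (canvas n as S) vertices_loop (canvas n as (S \<union> (\<Union>v<n. vertex_arcs as v)))"
proof -
  define I where "I v s \<longleftrightarrow> canvas n as (S \<union> (\<Union>v'<v. vertex_arcs as v')) s \<and> s ''v'' 0 = v \<and>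
    s ''l'' 0 = length as" for v s
  let ?f = "''p'' ::= Minus (Var ''p'') (Const 1) ;; writes (middle_arcs (slot ''w'') (slot ''p'')) ;;
        ''v'' ::= Plus (Var ''v'') (Const 1)"
  let ?b = "''k'' ::= Var ''v'' ;; search ''tl'' ;; ''w'' ::= Minus (Var ''p'') (Const 1) ;; search ''hd'' ;; ?f"
  have "ht (I 0) (While (Minus (Var ''n'') (Var ''v'')) ?b) (I n)"
  proof (rule ht_While)
    fix v assume v: "v < n"
    define c where "c t = last (cols as t v)" for t
    have c: "c t < length as" "found (key as t) v (length as) = Suc (30 * c t)" for t
      using last_in_set[OF cols[OF v, of t]] cols[OF v, of t] by (auto simp: c_def cols_def found_cols)
    define P where "P s \<longleftrightarrow> I v s \<and> s ''k'' 0 = v" for s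
    \<comment> \<open>The result of the first search is saved in \<open>''w''\<close> since the
      second one overwrites \<open>''p''\<close>.\<close>
    define P' where "P' s \<longleftrightarrow> P s \<and> s ''w'' 0 = 30 * c False" for s
    have arr: "s (array t) e = key as t e" if "P s" "e < length as" for s t e
      using ready_array[of n as s e t] that by (simp add: P_def I_def canvas_def)
    have "ht (I v) (''k'' ::= Var ''v'') P"
      by (rule ht_wpI) (use B v in \<open>simp add: P_def I_def canvas_defs\<close>)
    moreover have "ht P (search ''tl'') (\<lambda>s. P s \<and> s ''p'' 0 = Suc (30 * c False))"
      unfolding c(2)[symmetric]
    proof (rule ht_search)
      show "frame {''p'', ''q'', ''c''} P"
        by (rule frameI) (simp add: P_def I_def canvas_defs)
      show "s ''k'' 0 = v \<and> s ''l'' 0 = length as \<and> (\<forall>e'<length as. s ''tl'' e' = key as False e')" if "P s" for s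
        using that arr[OF that, of _ False] by (simp add: P_def I_def array_def)
    qed (use B R in auto)
    moreover have "ht (\<lambda>s. P s \<and> s ''p'' 0 = Suc (30 * c False)) (''w'' ::= Minus (Var ''p'') (Const 1)) P'"
      by (rule ht_wpI) (use B c(1)[of False] in \<open>simp add: P'_def P_def I_def canvas_defs\<close>)
    moreover have "ht P' (search ''hd'') (\<lambda>s. P' s \<and> s ''p'' 0 = Suc (30 * c True))"
      unfolding c(2)[symmetric]
    proof (rule ht_search)
      show "frame {''p'', ''q'', ''c''} P'"
        by (rule frameI) (simp add: P'_def P_def I_def canvas_defs)
      show "s ''k'' 0 = v \<and> s ''l'' 0 = length as \<and> (\<forall>e'<length as. s ''hd'' e' = key as True e')" if "P' s" for s
        using that arr[of s _ True] by (simp add: P'_def P_def I_def array_def)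
    qed (use B R in auto)
    moreover have "ht (\<lambda>s. P' s \<and> s ''p'' 0 = Suc (30 * c True)) ?f (I (Suc v))"
    proof (rule ht_wpI)
      let ?S = "S \<union> (\<Union>v'<v. vertex_arcs as v')"
      let ?ys = "middle_arcs (Pair (c False)) (Pair (c True))"
      fix s assume s: "P' s \<and> s ''p'' 0 = Suc (30 * c True)"
      let ?s = "s(''p'' := (s ''p'')(0 := 30 * c True))"
      have U: "S \<union> (\<Union>v'<Suc v. vertex_arcs as v') = ?S \<union> set ?ys"
        by (auto simp: vertex_arcs_def c_def less_Suc_eq)
      have "wp (writes (middle_arcs (slot ''w'') (slot ''p''))) (wp (''v'' ::= Plus (Var ''v'') (Const 1)) (I (Suc v))) ?s"
      proof (rule wp_draw)
        show "canvas n as ?S ?s" using s by (simp add: P'_def P_def I_def canvas_defs)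
        show "map (map_prod (addr ?s) (addr ?s)) (middle_arcs (slot ''w'') (slot ''p'')) = map (map_prod code code) ?ys"
          unfolding map_arcs using s by (simp add: P'_def addr_slot)
        show "fst x \<noteq> ''out'' \<and> fst y \<noteq> ''out''" if "(x, y) \<in> set (middle_arcs (slot ''w'') (slot ''p''))" for x y
          using arcs_in_range(4)[OF that] by (auto simp: slot_def)
        show "x \<in> gverts as" if "(x, y) \<in> set ?ys" for x y
          using arcs_in_range(4)[OF that] c(1) by (auto simp: gverts_def)
        show "wp (''v'' ::= Plus (Var ''v'') (Const 1)) (I (Suc v))
            (?s(''out'' := matrix (30 * length as) (map_prod code code ` (?S \<union> set ?ys))))"
          unfolding I_def U using s v B by (simp add: P'_def P_def I_def canvas_defs)
      qed (use B in simp)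
      then show "wp ?f (I (Suc v)) s" using s B c(1)[of True] by simp
    qed
    ultimately show "ht (I v) ?b (I (Suc v))" by (blast intro: ht_Seq)
  qed (use R in \<open>auto simp: I_def canvas_defs\<close>)
  then have "ht (wp (''v'' ::= Const 0) (wp (''l'' ::= Var ''m'') (I 0))) vertices_loop (I n)"
    unfolding vertices_loop_def by (intro ht_prefix)
  then show ?thesis
    by (rule ht_conseq) (use B in \<open>simp_all add: I_def canvas_defs bndD\<close>)
qed

lemma ht_rows_loop:
  assumes B: "(30 * length as) * (30 * length as) + 30 * length as + 1 \<le> B" and R: "30 * length as \<le> R"
  shows "ht (\<lambda>s. ready n as s \<and> drawn as {} s) rows_loop (canvas n as {})"
proof -
  define N where "N = 30 * length as"
  define I where "I x s \<longleftrightarrow> ready n as s \<and> drawn as {} s \<and> s ''x'' 0 = x \<and> (\<forall>y\<le>x. s ''row'' y = Suc (y * N))" for x s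
  let ?b = "Assign ''row'' (Plus (Var ''x'') (Const 1)) (Plus (Cell ''row'' (Var ''x'')) (Var ''N'')) ;;
        ''x'' ::= Plus (Var ''x'') (Const 1)"
  have "ht (I 0) (While (Minus (Var ''N'') (Var ''x'')) ?b) (I N)"
  proof (rule ht_While)
    fix x assume x: "x < N"
    \<comment> \<open>The largest number ever stored is the last table entry,
      \<open>1 + N * N\<close>.\<close>
    have "Suc x * N \<le> N * N" using x by (intro mult_right_mono) auto
    then have b: "Suc (N + x * N) \<le> B" "Suc x \<le> B" using B x by (simp_all add: N_def)
    show "ht (I x) ?b (I (Suc x))"
    proof (rule ht_wpI)
      fix s assume "I x s"
      then show "wp ?b (I (Suc x)) s"
        using b by (auto simp: I_def ready_def drawn_def N_def le_Suc_eq)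
    qed
  qed (use R in \<open>auto simp: I_def ready_def N_def\<close>)
  then have "ht (wp (''x'' ::= Const 0) (wp (Assign ''row'' (Const 0) (Const 1)) (I 0))) rows_loop (I N)"
    unfolding rows_loop_def by (intro ht_prefix)
  then show ?thesis
    by (rule ht_conseq) (use B in \<open>simp_all add: I_def canvas_defs N_def\<close>)
qed

lemma ht_finish:
  assumes "(30 * length as) * (30 * length as) + 1 \<le> B" "30 * length as \<le> B"
  shows "ht (canvas n as S) finish (\<lambda>s. s ''outlen'' 0 = Suc (30 * length as * (30 * length as)) \<and>
     s ''out'' 0 = 30 * length as \<and>
     (\<forall>p. s ''out'' (Suc p) = matrix (30 * length as) (map_prod code code ` S) (Suc p)))"
  by (rule ht_wpI) (use assms in \<open>simp add: finish_def canvas_defs\<close>)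

end

section \<open>The reduction\<close>

definition good :: "nat \<Rightarrow> (nat \<times> nat) list \<Rightarrow> bool" where
  "good n as \<longleftrightarrow> (\<forall>v<n. v \<in> fst ` set as \<and> v \<in> snd ` set as)"

text \<open>
  A digraph in which some vertex has no incoming or no outgoing arc has no Hamiltonian cycle. It is
  replaced by two disjoint directed 2-cycles, where every vertex has both kinds of arcs.
\<close>

definition fallback :: "(nat \<times> nat) list" where
  "fallback = [(0, 1), (1, 0), (2, 3), (3, 2)]"

definition normal :: "nat \<Rightarrow> (nat \<times> nat) list \<Rightarrow> nat \<times> (nat \<times> nat) list" where
  "normal n as = (if good n as then (n, as) else (4, fallback))"

text \<open>Row by row, as the program reads the matrix; the order matters because it lines up the
  columns. The cutoff \<open>k\<close> is the loop counter of \<open>scan\<close>.\<close>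

definition scanned :: "(nat \<Rightarrow> nat \<Rightarrow> bool) \<Rightarrow> nat \<Rightarrow> nat \<Rightarrow> (nat \<times> nat) list" where
  "scanned A n k = map (\<lambda>q. (q div n, q mod n)) (filter (\<lambda>q. A (q div n) (q mod n)) [0..<k])"

definition gadget_graph :: "(nat \<times> nat) list \<Rightarrow> nat pair_pre_digraph" where
  "gadget_graph as = \<lparr>pverts = {..<30 * length as}, parcs = map_prod code code ` garcs as\<rparr>"

definition transform :: "nat pair_pre_digraph \<Rightarrow> nat pair_pre_digraph" where
  "transform G = (let n = card (pverts G) in
     gadget_graph (snd (normal n (scanned (\<lambda>i j. (i, j) \<in> parcs G) n (n * n)))))"

lemma scanned_Suc:
  "scanned A n (Suc k) = scanned A n k @ (if A (k div n) (k mod n) then [(k div n, k mod n)] else [])"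
  by (simp add: scanned_def)

lemma length_scanned: "length (scanned A n k) \<le> k"
  by (simp add: scanned_def) (metis length_filter_le length_upt minus_nat.diff_0)

lemma distinct_scanned: "distinct (scanned A n k)"
proof -
  have "inj_on (\<lambda>q. (q div n, q mod n)) S" for S
    by (rule inj_onI) (metis div_mult_mod_eq prod.inject)
  then show ?thesis by (simp add: scanned_def distinct_map)
qed

lemma set_scanned:
  assumes "\<And>i j. A i j \<Longrightarrow> i < n \<and> j < n"
  shows "set (scanned A n (n * n)) = {(i, j). A i j}"
proof (intro equalityI subsetI)
  fix p assume "p \<in> {(i, j). A i j}"
  then obtain i j where p: "p = (i, j)" "A i j" by auto
  with assms have ij: "i < n" "j < n" by auto
  have "Suc i * n \<le> n * n" using ij by (intro mult_right_mono) auto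
  then have "i * n + j < n * n" using ij by simp
  moreover have "(i * n + j) div n = i" "(i * n + j) mod n = j" using ij by auto
  ultimately show "p \<in> set (scanned A n (n * n))"
    using p by (auto simp: scanned_def intro!: image_eqI[of _ _ "i * n + j"])
qed (auto simp: scanned_def)

lemma matrix_rows:
  assumes "0 < n"
  shows "[f i j. i \<leftarrow> [0..<m], j \<leftarrow> [0..<n]] = map (\<lambda>q. f (q div n) (q mod n)) [0..<m * n]"
proof (induction m)
  case (Suc m)
  have split: "[0..<Suc m * n] = [0..<m * n] @ [m * n..<m * n + n]"
    using upt_add_eq_append[of 0 "m * n" n] by (simp add: add.commute)
  have row: "map (\<lambda>q. f (q div n) (q mod n)) [m * n..<m * n + n] = map (f m) [0..<n]"
    by (rule nth_equalityI) (use assms in simp_all)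
  have "[f i j. i \<leftarrow> [0..<Suc m], j \<leftarrow> [0..<n]] = [f i j. i \<leftarrow> [0..<m], j \<leftarrow> [0..<n]] @ map (f m) [0..<n]"
    by simp
  then show ?case unfolding split map_append row Suc .
qed simp

lemma encode_eq:
  assumes "pverts G = {..<n}" "0 < n"
  shows "encode G = n # map (\<lambda>q. if (q div n, q mod n) \<in> parcs G then 1 else 0) [0..<n * n]"
proof -
  have "card (pverts G) = n" using assms(1) by simp
  then show ?thesis
    unfolding encode_def Let_def
    using matrix_rows[OF assms(2), of "\<lambda>i j. if (i, j) \<in> parcs G then 1 else 0 :: nat" n] by (simp only:)
qed

lemma code_inj_on: "inj_on code S"
  by (rule inj_on_subset[OF code_inj subset_UNIV])

lemma finite_gverts: "finite (gverts as)"
  by (rule finite_imageD[OF _ code_inj_on]) (simp add: code_image)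

context reduction
begin

lemma pair_graph_gadget: "pair_graph (gadget_graph as)"
proof -
  have sub: "map_prod code code ` E \<subseteq> {..<30 * m} \<times> {..<30 * m}"
    using garcs_sub unfolding code_image[symmetric] by auto
  have finE: "finite (map_prod code code ` E)"
    using finite_subset[OF sub] by simp
  have irrefl: "code x \<noteq> code y" if "(x, y) \<in> E" for x y
    using that garcs_irrefl injD[OF code_inj] by metis
  have "sym (map_prod code code ` E)"
    using garcs_sym by (force simp: sym_def)
  with sub finE irrefl show ?thesis
    by unfold_locales (auto simp: gadget_graph_def symmetric_def)
qed

lemma card_gverts: "card V = 30 * m"
proof -
  have "card (code ` V) = card V"
    by (rule card_image[OF code_inj_on])
  then show ?thesis by (simp add: code_image)
qed

lemma cubic_gadget: "cubic (gadget_graph as)"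
  unfolding cubic_def
proof
  fix v assume "v \<in> pverts (gadget_graph as)"
  then obtain x where x: "x \<in> V" "v = code x"
    unfolding gadget_graph_def by (auto simp: code_image[symmetric])
  have "out_arcs (with_proj (gadget_graph as)) v = (\<lambda>y. (v, code y)) ` set (nbs as x)"
  proof (intro equalityI subsetI)
    fix p assume "p \<in> out_arcs (with_proj (gadget_graph as)) v"
    then obtain a b where ab: "(a, b) \<in> E" "p = (code a, code b)" "code a = code x"
      using x(2) by (auto simp: out_arcs_def gadget_graph_def)
    then have "a = x" using code_inj by (simp add: inj_eq)
    with ab x show "p \<in> (\<lambda>y. (v, code y)) ` set (nbs as x)" by (auto simp: garcs_def simp del: nbs.simps)
  next
    fix p assume "p \<in> (\<lambda>y. (v, code y)) ` set (nbs as x)"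
    then obtain y where "y \<in> set (nbs as x)" "p = map_prod code code (x, y)" using x(2) by auto
    with x(1) have "p \<in> map_prod code code ` E" "fst p = v" by (auto simp: garcs_def x(2) simp del: nbs.simps)
    then show "p \<in> out_arcs (with_proj (gadget_graph as)) v" by (simp add: out_arcs_def gadget_graph_def)
  qed
  moreover have "card ((\<lambda>y. (v, code y)) ` set (nbs as x)) = card (set (nbs as x))"
    using injD[OF code_inj] by (intro card_image) (auto simp: inj_on_def)
  moreover have "card (set (nbs as x)) = 3"
    using x(1) distinct_nbs by (auto simp: gverts_def distinct_card simp del: nbs.simps)
  ultimately show "out_degree (with_proj (gadget_graph as)) v = 3"
    by (simp add: out_degree_def)
qed

lemma card_arcs_gadget: "card (map_prod code code ` E) \<le> 90 * m"
proof -
  have "E = Sigma V (\<lambda>x. set (nbs as x))" by (auto simp: garcs_def)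
  then have "card E = (\<Sum>x\<in>V. card (set (nbs as x)))"
    by (simp add: finite_gverts)
  also have "\<dots> = (\<Sum>x\<in>V. 3)"
    using distinct_nbs by (intro sum.cong) (auto simp: gverts_def distinct_card simp del: nbs.simps)
  finally have "card E = 90 * m" by (simp add: card_gverts)
  moreover have "finite E" using finite_subset[OF garcs_sub] by (simp add: finite_gverts)
  ultimately show ?thesis using card_image_le[of E "map_prod code code"] by simp
qed

text \<open>Every edge comes from an arc, and for each arc of the digraph there are 30 vertices of
  out-degree 3.\<close>

lemma card_edges_gadget: "card (undirected_edges (gadget_graph as)) \<le> 90 * m"
proof -
  have "finite (map_prod code code ` E)" using finite_subset[OF garcs_sub] by (simp add: finite_gverts)
  moreover have "undirected_edges (gadget_graph as) = (\<lambda>(u, v). {u, v}) ` map_prod code code ` E"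
    by (force simp: undirected_edges_def gadget_graph_def)
  ultimately show ?thesis
    using card_image_le[of "map_prod code code ` E" "\<lambda>(u, v). {u, v}"] card_arcs_gadget by simp
qed

lemma nonempty_gadget: "pverts (gadget_graph as) \<noteq> {}"
proof -
  obtain e where "e < m" using key_surj[OF pos] by blast
  then have "0 < m" by linarith
  then have "0 \<in> pverts (gadget_graph as)" by (simp add: gadget_graph_def)
  then show ?thesis by blast
qed

lemma hamiltonian_gadget: "undirected_hamiltonian (gadget_graph as) \<longleftrightarrow> (\<exists>vs. ham (set as) {..<n} vs)"
proof -
  interpret G: pair_graph "gadget_graph as" by (rule pair_graph_gadget)
  have "undirected_hamiltonian (gadget_graph as) \<longleftrightarrow> (\<exists>vs. ham (map_prod code code ` E) (code ` V) vs \<and> 3 \<le> length vs)"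
    unfolding undirected_hamiltonian_iff[OF G.pair_wf_digraph]
    by (simp add: gadget_graph_def code_image)
  also have "\<dots> \<longleftrightarrow> (\<exists>vs. ham E V vs \<and> 3 \<le> length vs)"
    using ham_image_iff[OF inj_on_subset[OF code_inj] garcs_sub] by simp
  also have "\<dots> \<longleftrightarrow> (\<exists>vs. ham (set as) {..<n} vs)"
    using ham_from_gadgets gadgets_from_ham by blast
  finally show ?thesis .
qed

end

lemma fallback_reduction: "reduction 4 fallback"
  by unfold_locales (auto simp: fallback_def)

text \<open>A cycle that visits 0 never leaves the 2-cycle on 0 and 1.\<close>

lemma fallback_not_ham: "\<not> ham (set fallback) {..<4} vs"
proof
  assume ham: "ham (set fallback) {..<4} vs"
  then have "{..<4} \<subseteq> {0, 1 :: nat}"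
  proof (rule ham_succ_closed)
    fix i assume "i < length vs" "vs ! i \<in> {0, 1}"
    with ham_next[OF ham] show "vs ! (Suc i mod length vs) \<in> {0, 1}"
      by (fastforce simp: fallback_def)
  qed auto
  moreover have "2 \<in> {..<4 :: nat}" by simp
  ultimately have "2 \<in> {0, 1 :: nat}" by blast
  then show False by simp
qed

locale instance_graph =
  fixes G :: "nat pair_pre_digraph" and n :: nat
  assumes G: "hcp_instance G" and verts: "pverts G = {..<n}"
begin

sublocale pair_digraph G
  using G by (simp add: hcp_instance_def)

definition "as = scanned (\<lambda>i j. (i, j) \<in> parcs G) n (n * n)"
definition "as' = snd (normal n as)"
definition "n' = fst (normal n as)"

lemma set_as: "set as = parcs G"
  using wellformed' by (auto simp: as_def set_scanned verts)

lemma distinct_as: "distinct as"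
  by (simp add: as_def distinct_scanned)

lemma n_pos: "0 < n"
proof -
  obtain u v where "(u, v) \<in> parcs G" using G by (auto simp: hcp_instance_def)
  then have "u \<in> {..<n}" using wellformed' verts by auto
  then show ?thesis by auto
qed

lemma transform_eq: "transform G = gadget_graph as'"
  by (simp add: transform_def as'_def as_def verts)

lemma reduction_normal: "reduction n' as'"
proof (cases "good n as")
  case True
  have "reduction n as"
    by unfold_locales
      (use True n_pos wellformed' no_loops' distinct_as in \<open>auto simp: set_as verts good_def\<close>)
  then show ?thesis using True by (simp add: n'_def as'_def normal_def)
next
  case False
  then show ?thesis using fallback_reduction by (simp add: n'_def as'_def normal_def)
qed

lemma ham_normal: "(\<exists>vs. ham (set as') {..<n'} vs) \<longleftrightarrow> directed_hamiltonian G"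
proof (cases "good n as")
  case True
  then show ?thesis
    using directed_hamiltonian_iff[OF pair_wf_digraph] by (simp add: n'_def as'_def normal_def set_as verts)
next
  case False
  then have "\<not> directed_hamiltonian G"
    using directed_hamiltonian_iff[OF pair_wf_digraph] ham_degrees[of "parcs G" "pverts G"]
    by (auto simp: good_def set_as verts)
  with False show ?thesis by (simp add: n'_def as'_def normal_def fallback_not_ham)
qed

text \<open>The out-degrees alone count every arc once.\<close>

lemma card_parcs: "card (parcs G) \<le> degree_sum G"
proof -
  have "parcs G = (\<Union>v\<in>pverts G. out_arcs (with_proj G) v)"
    using wellformed' by (auto simp: out_arcs_def)
  then have "card (parcs G) = card (\<Union>v\<in>pverts G. out_arcs (with_proj G) v)" by simp
  also have "\<dots> = (\<Sum>v\<in>pverts G. out_degree (with_proj G) v)"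
    unfolding out_degree_def using pair_finite_verts pair_finite_arcs
    by (intro card_UN_disjoint) (auto simp: out_arcs_def)
  also have "\<dots> \<le> degree_sum G"
    unfolding degree_sum_def by (intro sum_mono) simp
  finally show ?thesis .
qed

text \<open>The factor 4 is the length of \<open>fallback\<close>; it suffices because an instance
  has an arc, so that its degree sum is positive.\<close>

lemma length_normal: "length as' \<le> 4 * degree_sum G"
proof -
  have "length as = card (parcs G)"
    using distinct_card[OF distinct_scanned] set_as by (metis as_def)
  moreover have "0 < card (parcs G)"
    using G pair_finite_arcs by (simp add: hcp_instance_def card_gt_0_iff)
  ultimately show ?thesis using card_parcs by (auto simp: as'_def normal_def fallback_def)
qed

end

section \<open>Verification of the input phase, and the polynomial time bound\<close>

lemma matrix_empty: "matrix N {} = (\<lambda>_. 0)"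
  by (rule ext) (simp add: matrix_def)

lemma good_iff_cols: "good n as \<longleftrightarrow> (\<forall>v<n. \<forall>t. cols as t v \<noteq> [])"
proof -
  have "v \<in> fst ` set as \<longleftrightarrow> cols as False v \<noteq> []" "v \<in> snd ` set as \<longleftrightarrow> cols as True v \<noteq> []" for v
    by (force simp: cols_def key_def filter_empty_conv in_set_conv_nth)+
  then show ?thesis by (simp add: good_def all_bool_eq conj_commute)
qed

definition input :: "(nat \<Rightarrow> nat \<Rightarrow> bool) \<Rightarrow> nat \<Rightarrow> state \<Rightarrow> bool" where
  "input A n s \<longleftrightarrow> s ''in'' 0 = n \<and> s ''inlen'' 0 = Suc (n * n) \<and>
     (\<forall>q<n * n. s ''in'' (Suc q) = (if A (q div n) (q mod n) then 1 else 0))"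

definition blank :: "state \<Rightarrow> bool" where
  "blank s \<longleftrightarrow> s ''out'' = (\<lambda>_. 0)"

context machine
begin

lemma ht_scan:
  assumes n: "0 < n" and B: "30 * (n * n) + 2 \<le> B" and R: "n * n \<le> R"
  shows "ht (\<lambda>s. input A n s \<and> blank s \<and> s ''m'' 0 = 0 \<and> s ''N'' 0 = 0 \<and> s ''i'' 0 = 0 \<and> s ''j'' 0 = 0)
    scan (\<lambda>s. ready n (scanned A n (n * n)) s \<and> blank s)"
proof -
  have "n \<le> n * n" using n by simp
  then have nB: "n \<le> B" using B by linarith
  define I where "I k s \<longleftrightarrow> input A n s \<and> blank s \<and> ready n (scanned A n k) s \<and>
    s ''pos'' 0 = Suc k \<and> s ''i'' 0 = k div n \<and> s ''j'' 0 = k mod n" for k s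
  let ?r = "If (Cell ''in'' (Var ''pos''))
          (Assign ''tl'' (Var ''m'') (Var ''i'') ;; Assign ''hd'' (Var ''m'') (Var ''j'') ;;
           ''m'' ::= Plus (Var ''m'') (Const 1) ;; ''N'' ::= Plus (Var ''N'') (Const 30)) Skip"
  let ?a = "''pos'' ::= Plus (Var ''pos'') (Const 1) ;; ''j'' ::= Plus (Var ''j'') (Const 1) ;;
        If (Minus (Var ''n'') (Var ''j'')) Skip (''j'' ::= Const 0 ;; ''i'' ::= Plus (Var ''i'') (Const 1))"
  have "ht (I 0) (While (Minus (Var ''inlen'') (Var ''pos'')) (?r ;; ?a)) (I (n * n))"
  proof (rule ht_While)
    fix k assume k: "k < n * n"
    \<comment> \<open>The state after the entry has been recorded and before the position
      advances.\<close>
    define M where "M s \<longleftrightarrow> input A n s \<and> blank s \<and> ready n (scanned A n (Suc k)) s \<and>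
      s ''pos'' 0 = Suc k \<and> s ''i'' 0 = k div n \<and> s ''j'' 0 = k mod n" for s
    have len: "length (scanned A n k) \<le> k" by (rule length_scanned)
    have "k div n \<le> k" "n \<le> n * n" using n by auto
    then have kB: "k div n < B" "k mod n < n" "n \<le> B" using n B k by (linarith, simp, linarith)
    have "ht (I k) ?r M"
    proof (rule ht_wpI)
      fix s assume s: "I k s"
      have i: "s ''in'' (Suc k) = (if A (k div n) (k mod n) then 1 else 0)"
        using s k by (simp add: I_def input_def)
      show "wp ?r M s"
      proof (cases "A (k div n) (k mod n)")
        case True
        show ?thesis
          using s i True len kB k B
          by (simp add: I_def M_def input_def blank_def ready_def scanned_Suc nth_append less_Suc_eq)
      next
        case False
        then show ?thesis using s i by (simp add: I_def M_def scanned_Suc)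
      qed
    qed
    moreover have "ht M ?a (I (Suc k))"
    proof (rule ht_wpI)
      fix s assume s: "M s"
      show "wp ?a (I (Suc k)) s"
      proof (cases "Suc (k mod n) = n")
        case True
        then have "Suc k div n = Suc (k div n)" "Suc k mod n = 0"
          by (simp_all add: div_Suc mod_Suc)
        then show ?thesis
          using s True kB k B by (simp add: I_def M_def input_def blank_def ready_def)
      next
        case False
        then have "Suc k div n = k div n" "Suc k mod n = Suc (k mod n)" "Suc (k mod n) < n"
          using kB by (simp_all add: div_Suc mod_Suc)
        then show ?thesis
          using s False kB k B by (simp add: I_def M_def input_def blank_def ready_def)
      qed
    qed
    ultimately show "ht (I k) (?r ;; ?a) (I (Suc k))" by (rule ht_Seq)
  qed (use R in \<open>auto simp: I_def input_def\<close>)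
  then have "ht (wp (''n'' ::= Cell ''in'' (Const 0)) (wp (''pos'' ::= Const 1) (I 0))) scan (I (n * n))"
    unfolding scan_def by (intro ht_prefix)
  then show ?thesis
    by (rule ht_conseq) (use B nB in \<open>simp_all add: I_def input_def blank_def ready_def scanned_def bndD\<close>)
qed

lemma ht_check:
  assumes B: "30 * length as + 30 \<le> B" "n \<le> B" and R: "length as \<le> R" "n \<le> R"
  shows "ht (\<lambda>s. ready n as s \<and> blank s) check
    (\<lambda>s. ready n as s \<and> blank s \<and> (s ''bad'' 0 = 0 \<longleftrightarrow> good n as))"
proof -
  define I where "I v s \<longleftrightarrow> ready n as s \<and> blank s \<and> s ''v'' 0 = v \<and> s ''l'' 0 = length as \<and>
    (s ''bad'' 0 = 0 \<longleftrightarrow> (\<forall>u<v. \<forall>t. cols as t u \<noteq> []))" for v s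
  let ?i = "If (Var ''p'') Skip (''bad'' ::= Const 1)"
  let ?u = "''v'' ::= Plus (Var ''v'') (Const 1)"
  have "ht (I 0) (While (Minus (Var ''n'') (Var ''v''))
    (''k'' ::= Var ''v'' ;; search ''tl'' ;; ?i ;; search ''hd'' ;; ?i ;; ?u)) (I n)"
  proof (rule ht_While)
    fix v assume v: "v < n"
    \<comment> \<open>The parameter \<open>b\<close> holds the outcome of the searches already made
      for the current vertex.\<close>
    define P where "P b s \<longleftrightarrow> ready n as s \<and> blank s \<and> s ''v'' 0 = v \<and> s ''l'' 0 = length as \<and>
      s ''k'' 0 = v \<and> (s ''bad'' 0 = 0 \<longleftrightarrow> (\<forall>u<v. \<forall>t. cols as t u \<noteq> []) \<and> b)" for b s
    have search: "ht (P b) (search (array t)) (\<lambda>s. P b s \<and> s ''p'' 0 = found (key as t) v (length as))" for b t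
    proof (rule ht_search)
      show "frame {''p'', ''q'', ''c''} (P b)"
        by (rule frameI) (simp add: P_def ready_def blank_def)
      show "s ''k'' 0 = v \<and> s ''l'' 0 = length as \<and> (\<forall>e<length as. s (array t) e = key as t e)" if "P b s" for s
        using that ready_array[of n as s] by (simp add: P_def)
    qed (use B R in \<open>auto simp: array_def\<close>)
    have mark: "ht (\<lambda>s. P b s \<and> s ''p'' 0 = found (key as t) v (length as)) ?i (P (b \<and> cols as t v \<noteq> []))" for b t
      by (rule ht_wpI) (use B in \<open>auto simp: P_def ready_def blank_def found_cols\<close>)
    have "ht (I v) (''k'' ::= Var ''v'') (P True)"
      by (rule ht_wpI) (use B v in \<open>simp add: P_def I_def ready_def blank_def\<close>)
    moreover note search[of True False] mark[of True False]
      search[of "True \<and> cols as False v \<noteq> []" True] mark[of "True \<and> cols as False v \<noteq> []" True]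
    moreover have "ht (P ((True \<and> cols as False v \<noteq> []) \<and> cols as True v \<noteq> [])) ?u (I (Suc v))"
      by (rule ht_wpI) (use B v in \<open>auto simp: P_def I_def ready_def blank_def less_Suc_eq all_bool_eq\<close>)
    ultimately show "ht (I v) (''k'' ::= Var ''v'' ;; search ''tl'' ;; ?i ;; search ''hd'' ;; ?i ;; ?u) (I (Suc v))"
      unfolding array_def if_True if_False by (blast intro: ht_Seq)
  qed (use R in \<open>auto simp: I_def ready_def\<close>)
  then have "ht (wp (''v'' ::= Const 0) (wp (''bad'' ::= Const 0) (wp (''l'' ::= Var ''m'') (I 0)))) check (I n)"
    unfolding check_def by (intro ht_prefix)
  then show ?thesis
    by (rule ht_conseq) (use B in \<open>simp_all add: I_def ready_def blank_def bndD good_iff_cols\<close>)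
qed

lemma ht_repair:
  assumes "120 \<le> B"
  shows "ht (\<lambda>s. ready n as s \<and> blank s \<and> (s ''bad'' 0 = 0 \<longleftrightarrow> good n as)) repair
    (\<lambda>s. ready (fst (normal n as)) (snd (normal n as)) s \<and> drawn (snd (normal n as)) {} s)"
proof (rule ht_wpI)
  fix s assume s: "ready n as s \<and> blank s \<and> (s ''bad'' 0 = 0 \<longleftrightarrow> good n as)"
  have blank: "blank s' \<Longrightarrow> drawn bs {} s'" for s' bs
    by (simp add: blank_def drawn_def matrix_empty)
  show "wp repair (\<lambda>s. ready (fst (normal n as)) (snd (normal n as)) s \<and> drawn (snd (normal n as)) {} s) s"
  proof (cases "good n as")
    case True
    with s blank show ?thesis by (simp add: repair_def normal_def)
  next
    case False
    then show ?thesis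
      using s assms by (simp add: repair_def normal_def ready_def fallback_def All_less_Suc drawn_def blank_def matrix_empty)
  qed
qed

text \<open>The longest loop runs over the vertices of the output: at most 30 for each of at most
  \<open>n * n\<close> arcs, or 120 after a repair. The bound \<open>B\<close> accommodates the
  square of their number, reached in the table of row addresses.\<close>

lemma ht_prog:
  assumes n: "0 < n" and R: "30 * (n * n) + 120 \<le> R" and B: "R * R + R + 1 \<le> B"
    and red: "reduction (fst (normal n (scanned A n (n * n)))) as" and as: "as = snd (normal n (scanned A n (n * n)))"
  shows "ht (\<lambda>s. input A n s \<and> blank s \<and> s ''m'' 0 = 0 \<and> s ''N'' 0 = 0 \<and> s ''i'' 0 = 0 \<and> s ''j'' 0 = 0)
    prog (\<lambda>s. s ''outlen'' 0 = Suc (30 * length as * (30 * length as)) \<and> s ''out'' 0 = 30 * length as \<and>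
     (\<forall>p. s ''out'' (Suc p) = matrix (30 * length as) (map_prod code code ` garcs as) (Suc p)))"
proof -
  define n' where "n' = fst (normal n (scanned A n (n * n)))"
  interpret reduction n' as using red by (simp add: n'_def)
  have len: "length (scanned A n (n * n)) \<le> n * n" by (rule length_scanned)
  have nn: "n \<le> n * n" using n by simp
  have m: "30 * length as \<le> R"
    using len R by (auto simp: as normal_def fallback_def)
  have nR: "n \<le> R" using nn R by linarith
  then have n'R: "n' \<le> R" using R by (simp add: n'_def normal_def)
  have RR: "R \<le> R * R" "30 \<le> R" using R by auto
  have sq: "30 * length as * (30 * length as) \<le> R * R" using m by (intro mult_mono) auto
  have mB: "30 * length as + 30 \<le> B" using m RR B by linarith
  have cols: "cols as t v \<noteq> []" if "v < n'" for v t using cols_nonempty[OF that] .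
  have "ht (\<lambda>s. input A n s \<and> blank s \<and> s ''m'' 0 = 0 \<and> s ''N'' 0 = 0 \<and> s ''i'' 0 = 0 \<and> s ''j'' 0 = 0)
    scan (\<lambda>s. ready n (scanned A n (n * n)) s \<and> blank s)"
    using n R B RR by (intro ht_scan) auto
  moreover have "ht (\<lambda>s. ready n (scanned A n (n * n)) s \<and> blank s) check
    (\<lambda>s. ready n (scanned A n (n * n)) s \<and> blank s \<and> (s ''bad'' 0 = 0 \<longleftrightarrow> good n (scanned A n (n * n))))"
    using n R B RR len nR by (intro ht_check) auto
  moreover have "ht (\<lambda>s. ready n (scanned A n (n * n)) s \<and> blank s \<and> (s ''bad'' 0 = 0 \<longleftrightarrow> good n (scanned A n (n * n)))) repair
    (\<lambda>s. ready n' as s \<and> drawn as {} s)"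
    unfolding n'_def as using R B by (intro ht_repair) auto
  moreover have "ht (\<lambda>s. ready n' as s \<and> drawn as {} s) rows_loop (canvas n' as {})"
    using m sq B by (intro ht_rows_loop) auto
  moreover have "ht (canvas n' as {}) arcs_loop (canvas n' as (\<Union>e<length as. arc_arcs as e))"
    using m mB by (intro ht_arcs_loop) auto
  moreover have "ht (canvas n' as (\<Union>e<length as. arc_arcs as e)) vertices_loop (canvas n' as (garcs as))"
    unfolding arcs_decomposition using m mB B n'R cols by (intro ht_vertices_loop) auto
  moreover have "ht (canvas n' as (garcs as)) finish (\<lambda>s. s ''outlen'' 0 = Suc (30 * length as * (30 * length as)) \<and>
     s ''out'' 0 = 30 * length as \<and>
     (\<forall>p. s ''out'' (Suc p) = matrix (30 * length as) (map_prod code code ` garcs as) (Suc p)))"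
    using m sq B by (intro ht_finish) auto
  ultimately show ?thesis unfolding prog_def by (blast intro: ht_Seq)
qed

end

lemma matrix_entry:
  assumes "S \<subseteq> {..<N} \<times> {..<N}" "p < N * N"
  shows "matrix N S (Suc p) = (if (p div N, p mod N) \<in> S then 1 else 0)"
proof -
  have "(\<exists>(x, y)\<in>S. Suc p = Suc (x * N + y)) \<longleftrightarrow> (p div N, p mod N) \<in> S"
  proof
    assume "\<exists>(x, y)\<in>S. Suc p = Suc (x * N + y)"
    then obtain x y where "(x, y) \<in> S" "p = x * N + y" by auto
    moreover from this(1) assms have "y < N" by auto
    ultimately show "(p div N, p mod N) \<in> S" by simp
  next
    assume "(p div N, p mod N) \<in> S"
    moreover have "Suc p = Suc (p div N * N + p mod N)" by simp
    ultimately show "\<exists>(x, y)\<in>S. Suc p = Suc (x * N + y)" by blast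
  qed
  then show ?thesis by (simp add: matrix_def)
qed

lemma bitsize_ge: "length xs \<le> bitsize xs"
  unfolding bitsize_def by (induction xs) auto

lemma bitsize_bits: "set xs \<subseteq> {0, 1} \<Longrightarrow> bitsize xs \<le> 2 * length xs"
proof (induction xs)
  case (Cons x xs)
  then have "floorlog 2 x \<le> 1" using floorlog_le[of x] by auto
  with Cons show ?case by (simp add: bitsize_def)
qed (simp add: bitsize_def)

context instance_graph
begin

lemma input_initial:
  "input (\<lambda>i j. (i, j) \<in> parcs G) n (initial_state (encode G)) \<and> blank (initial_state (encode G)) \<and>
   initial_state (encode G) ''m'' 0 = 0 \<and> initial_state (encode G) ''N'' 0 = 0 \<and>
   initial_state (encode G) ''i'' 0 = 0 \<and> initial_state (encode G) ''j'' 0 = 0"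
  unfolding encode_eq[OF verts n_pos]
  by (auto simp: input_def blank_def initial_state_def)

lemma bnd_initial:
  assumes "n * n + 1 \<le> B"
  shows "bnd B (initial_state (encode G))"
proof -
  have "x \<le> B" if "x \<in> set (encode G)" for x
  proof -
    have "n \<le> n * n" using n_pos by simp
    then have "n \<le> B" using assms by linarith
    then show ?thesis using that assms unfolding encode_eq[OF verts n_pos] by (auto split: if_splits)
  qed
  moreover have "length (encode G) \<le> B" using assms unfolding encode_eq[OF verts n_pos] by simp
  ultimately show ?thesis by (auto simp: bnd_def initial_state_def)
qed

text \<open>The summand \<open>3 * B\<close> pays for the output: at most \<open>R * R\<close>
  matrix entries of size at most 2 each, and the number of vertices.\<close>

lemma run:
  assumes R: "30 * (n * n) + 120 \<le> R" and B: "R * R + R + 1 \<le> B"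
  shows "\<exists>t s. exec prog (initial_state (encode G)) t s \<and> result s = encode (transform G) \<and>
    t + bitsize (result s) \<le> machine.budget R B prog + 3 * B"
proof -
  interpret machine R B .
  interpret red: reduction n' as' by (rule reduction_normal)
  let ?N = "30 * length as'"
  have "n * n + 1 \<le> B" using R B by linarith
  note init = bnd_initial[OF this]
  from htD[OF ht_prog[OF n_pos R B _ as'_def[unfolded as_def]] input_initial init] red.reduction_axioms
  obtain t s where ts: "exec prog (initial_state (encode G)) t s" "t \<le> budget prog"
    and s: "s ''outlen'' 0 = Suc (?N * ?N)" "s ''out'' 0 = ?N"
      "\<And>p. s ''out'' (Suc p) = matrix ?N (map_prod code code ` garcs as') (Suc p)"
    unfolding n'_def as_def by blast
  have sub: "map_prod code code ` garcs as' \<subseteq> {..<?N} \<times> {..<?N}"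
    using red.garcs_sub unfolding code_image[symmetric] by auto
  have N0: "0 < ?N" using red.nonempty_gadget by (auto simp: gadget_graph_def)
  have enc: "encode (transform G) = ?N # map (\<lambda>q. if (q div ?N, q mod ?N) \<in> map_prod code code ` garcs as' then 1 else 0) [0..<?N * ?N]"
    unfolding transform_eq using encode_eq[of "gadget_graph as'" ?N] N0 by (simp add: gadget_graph_def)
  have "result s = s ''out'' 0 # map (\<lambda>p. s ''out'' (Suc p)) [0..<?N * ?N]"
    unfolding result_def s(1) map_upt_Suc by simp
  also have "\<dots> = encode (transform G)"
    unfolding enc s(2,3) using matrix_entry[OF sub] by simp
  finally have res: "result s = encode (transform G)" .
  have N: "?N \<le> R"
  proof -
    have "length as \<le> n * n" unfolding as_def by (rule length_scanned)
    then show ?thesis using R by (auto simp: as'_def normal_def fallback_def)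
  qed
  then have "?N * ?N \<le> R * R" by (intro mult_mono) auto
  moreover have "bitsize (result s) \<le> 1 + ?N + 2 * (?N * ?N)"
  proof -
    let ?bs = "map (\<lambda>q. if (q div ?N, q mod ?N) \<in> map_prod code code ` garcs as' then 1 else 0 :: nat) [0..<?N * ?N]"
    have "bitsize (result s) = 1 + floorlog 2 ?N + bitsize ?bs" unfolding res enc by (simp add: bitsize_def)
    moreover have "bitsize ?bs \<le> 2 * length ?bs" by (rule bitsize_bits) auto
    ultimately show ?thesis using floorlog_le[of ?N] by simp
  qed
  ultimately have "bitsize (result s) \<le> 3 * B" using N B by linarith
  with ts res show ?thesis by (intro exI[of _ t] exI[of _ s]) simp
qed

end

lemma polytime_transform: "polytime_computable_on {G. hcp_instance G} encode encode transform"
proof -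
  \<comment> \<open>\<open>r\<close> and \<open>b\<close> are \<open>R\<close> and \<open>B\<close>
    as polynomials in the input size, which is at least \<open>n * n\<close> since every matrix
    entry contributes at least 1.\<close>
  define r :: "nat poly" where "r = [:120, 30:]"
  define b where "b = r * r + r + 1"
  define p where "p = [:work prog:] * (r + 1) ^ depth prog * (b + 1) + [:3:] * b"
  have "\<exists>t s. exec prog (initial_state (encode G)) t s \<and> result s = encode (transform G) \<and>
    t + bitsize (result s) \<le> poly p (bitsize (encode G))" if G: "hcp_instance G" for G
  proof -
    obtain n where "pverts G = {..<n}" using G by (auto simp: hcp_instance_def numbered_def)
    then interpret instance_graph G n using G by unfold_locales
    define S where "S = bitsize (encode G)"
    have "n * n \<le> S"
      using bitsize_ge[of "encode G"] unfolding S_def encode_eq[OF verts n_pos] by simp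
    then have R: "30 * (n * n) + 120 \<le> poly r S" by (simp add: r_def)
    have B: "poly r S * poly r S + poly r S + 1 \<le> poly b S" by (simp add: b_def)
    have "poly p S = machine.budget (poly r S) (poly b S) prog + 3 * poly b S"
      by (simp add: p_def machine.budget_def algebra_simps)
    with run[OF R B] show ?thesis unfolding S_def by simp
  qed
  then show ?thesis unfolding polytime_computable_on_def by blast
qed

theorem theorem5p3:
  shows "\<exists>(C :: nat) (f :: nat pair_pre_digraph \<Rightarrow> nat pair_pre_digraph).
    polytime_computable_on {G. hcp_instance G} encode encode f \<and>
    (\<forall>G. hcp_instance G \<longrightarrow>
       pair_graph (f G) \<and> numbered (f G) \<and> pverts (f G) \<noteq> {} \<and> cubic (f G) \<and>
       (undirected_hamiltonian (f G) \<longleftrightarrow> directed_hamiltonian G) \<and>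
       card (pverts (f G)) \<le> C * degree_sum G \<and>
       card (undirected_edges (f G)) \<le> C * degree_sum G)"
proof (intro exI conjI allI impI)
  show "polytime_computable_on {G. hcp_instance G} encode encode transform"
    by (rule polytime_transform)
  fix G assume G: "hcp_instance G"
  then obtain n where "pverts G = {..<n}" by (auto simp: hcp_instance_def numbered_def)
  then interpret instance_graph G n using G by unfold_locales
  interpret red: reduction n' as' by (rule reduction_normal)
  show "pair_graph (transform G)" "cubic (transform G)" "pverts (transform G) \<noteq> {}"
    unfolding transform_eq by (rule red.pair_graph_gadget red.cubic_gadget red.nonempty_gadget)+
  show "numbered (transform G)"
    unfolding transform_eq by (auto simp: numbered_def gadget_graph_def)
  show "undirected_hamiltonian (transform G) \<longleftrightarrow> directed_hamiltonian G"
    unfolding transform_eq red.hamiltonian_gadget by (rule ham_normal)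
  \<comment> \<open>360 is 90 times 4, as needed for the edges; the vertices would allow 30 times
    4.\<close>
  show "card (pverts (transform G)) \<le> 360 * degree_sum G"
    using length_normal unfolding transform_eq by (simp add: gadget_graph_def)
  show "card (undirected_edges (transform G)) \<le> 360 * degree_sum G"
    using length_normal red.card_edges_gadget unfolding transform_eq by simp
qed

end
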